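(* For every graph $H$ with tree-depth $3$ that has at most one connected component of tree-depth $3$, the defective chromatic number of the class of $H$-minor-free graphs equals $2$.
   Context: The tree-depth of a connected graph $H$ is the minimum height (maximum number of vertices on a root-to-leaf path) of a rooted tree $T$ such that $H$ is a subgraph of the closure of $T$ (obtained from $T$ by adding an edge between every ancestor and descendant); for disconnected $H$ it is the maximum tree-depth of its components. A graph is $(k,d)$-colourable if each vertex can be given one of $k$ colours so that each vertex has at most $d$ neighbours of its own colour. The defective chromatic number of a class is the minimum $k$ such that for some $d$ every graph in the class is $(k,d)$-colourable. *)

theory Defs
  imports "Graph_Theory.Graph_Theory" "HOL-Library.Extended_Nat" "HOL-Library.Disjoint_Sets"
begin

text \<open>
  Finite simple undirected graphs are the symmetric digraphs of the locale \<^locale>\<open>graph\<close>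
  (finite, loop-free, no parallel arcs): an edge is a pair of opposite arcs. Hence
  \<^const>\<open>pre_digraph.sccs\<close> yields the connected components, as induced subgraphs.
\<close>

text \<open>
  The predicate \<^const>\<open>tree\<close> of the library forbids directed cycles; since \<open>u, v, u\<close> is one in a
  symmetric digraph, trees are defined here by unique paths instead.
\<close>

definition rooted_tree :: "('a, 'b) pre_digraph \<Rightarrow> 'a \<Rightarrow> bool" where
  "rooted_tree T r \<longleftrightarrow> graph T \<and> r \<in> verts T \<and>
     (\<forall>u \<in> verts T. \<forall>v \<in> verts T. \<exists>!p. pre_digraph.apath T u p v)"

text \<open>Every vertex is an ancestor of itself in the following sense.\<close>

definition ancestor :: "('a, 'b) pre_digraph \<Rightarrow> 'a \<Rightarrow> 'a \<Rightarrow> 'a \<Rightarrow> bool" where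
  "ancestor T r u v \<longleftrightarrow>
     (\<exists>p. pre_digraph.apath T r p v \<and> u \<in> set (pre_digraph.awalk_verts T r p))"

definition leaf :: "('a, 'b) pre_digraph \<Rightarrow> 'a \<Rightarrow> 'a \<Rightarrow> bool" where
  "leaf T r l \<longleftrightarrow> l \<in> verts T \<and> (\<forall>v. ancestor T r l v \<longrightarrow> v = l)"

definition tree_height :: "('a, 'b) pre_digraph \<Rightarrow> 'a \<Rightarrow> nat" where
  "tree_height T r =
     Max {length (pre_digraph.awalk_verts T r p) | p l. leaf T r l \<and> pre_digraph.apath T r p l}"

definition tree_closure :: "('a, 'b) pre_digraph \<Rightarrow> 'a \<Rightarrow> 'a pair_pre_digraph" where
  "tree_closure T r =
     \<lparr>pverts = verts T,
      parcs = {(u, v). u \<noteq> v \<and> (ancestor T r u v \<or> ancestor T r v u)}\<rparr>"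

text \<open>
  Being a subgraph of the closure is meant up to isomorphism; as \<^typ>\<open>nat\<close> is infinite, every
  finite rooted tree occurs, up to isomorphism, among those considered.
\<close>

definition connected_tree_depth :: "('a, 'b) pre_digraph \<Rightarrow> nat" where
  "connected_tree_depth H =
     (LEAST h. \<exists>(T :: (nat, nat \<times> nat) pre_digraph) r S.
        rooted_tree T r \<and> tree_height T r = h \<and>
        subgraph S (with_proj (tree_closure T r)) \<and> digraph_iso H S)"

text \<open>The supremum of a finite set of naturals is its maximum, and 0 if the set is empty.\<close>

definition tree_depth :: "('a, 'b) pre_digraph \<Rightarrow> nat" where
  "tree_depth H = (SUP C \<in> pre_digraph.sccs H. connected_tree_depth C)"

text \<open>
  \<open>B u\<close> is the branch set contracted to the vertex \<open>u\<close>. It is nonempty, because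
  \<^const>\<open>connected\<close> excludes the null graph.
\<close>

definition is_minor :: "('a, 'b) pre_digraph \<Rightarrow> ('c, 'd) pre_digraph \<Rightarrow> bool" where
  "is_minor H G \<longleftrightarrow>
     (\<exists>B. (\<forall>u \<in> verts H. B u \<subseteq> verts G \<and> connected (G \<restriction> B u)) \<and>
          disjoint_family_on B (verts H) \<and>
          (\<forall>u v. u \<rightarrow>\<^bsub>H\<^esub> v \<longrightarrow> (\<exists>x \<in> B u. \<exists>y \<in> B v. x \<rightarrow>\<^bsub>G\<^esub> y)))"

text \<open>Every finite simple graph is isomorphic to one of the type used for the members.\<close>

definition minor_free_graphs :: "('a, 'b) pre_digraph \<Rightarrow> (nat, nat \<times> nat) pre_digraph set" where
  "minor_free_graphs H = {G. graph G \<and> \<not> is_minor H G}"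

definition defective_colourable :: "nat \<Rightarrow> nat \<Rightarrow> ('a, 'b) pre_digraph \<Rightarrow> bool" where
  "defective_colourable k d G \<longleftrightarrow>
     (\<exists>c :: 'a \<Rightarrow> nat. (\<forall>v \<in> verts G. c v < k) \<and>
        (\<forall>v \<in> verts G. card {w \<in> verts G. v \<rightarrow>\<^bsub>G\<^esub> w \<and> c w = c v} \<le> d))"

text \<open>The value is \<open>\<infinity>\<close> if no number of colours suffices.\<close>

definition defective_chromatic_number :: "('a, 'b) pre_digraph set \<Rightarrow> enat" where
  "defective_chromatic_number \<G> =
     Inf {enat k | k. \<exists>d. \<forall>G \<in> \<G>. defective_colourable k d G}"

end

theory Submission
  imports Defs
begin

text \<open>
  Let \<open>F\<close> be the join of a vertex with \<open>k\<close> disjoint stars with \<open>k\<close> leaves each. Components of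
  tree-depth at most 2 are stars, and a component of tree-depth 3 becomes a star forest when its root
  is removed; hence \<open>H\<close> is a subgraph of \<open>F\<close> for large \<open>k\<close>, and it suffices to colour the graphs
  \<open>G\<close> without \<open>F\<close>-minor.

  A pair of vertices of \<open>G\<close> is heavy if it has many common neighbours. Excluding \<open>F\<close> bounds the number
  of heavy partners of a vertex, and the number of its neighbours that belong to heavy pairs at all.
  So one can reserve disjoint sets of common neighbours for all heavy pairs, and contract the
  components of the graph of heavy pairs through them. In the quotient, codegrees are bounded, again
  because \<open>F\<close> is excluded. As \<open>F\<close>-minor-free graphs are sparse, every subgraph of the quotient
  with an edge has a vertex of degree 1 or an edge with two ends of bounded degree, which gives a
  2-colouring of bounded defect. It lifts to \<open>G\<close>: each component of heavy pairs is monochromatic.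

  One colour does not suffice, because the minors of stars have tree-depth at most 2.
\<close>


section \<open>Connected sets and fan minors\<close>

text \<open>The model obstacle is the complete bipartite graph with parts of size 2 and n: it
  contains no fan minor with at least two stars of at least two leaves, yet each edge joins a vertex
  of degree 2 to one of degree n, so sparsity alone yields no edge between two vertices of bounded
  degree. Merging the two large vertices turns the others into vertices of degree 1; hence the two
  outcomes for the quotient. A codegree bound is what allows low vertices to be counted by the pairs
  of high vertices that they see.

  Merging has a price. A component of heavy pairs may be arbitrarily large and disconnected in the
  graph, and the vertices that connect it could swallow all common neighbours of another heavy pair,
  the very leaves from which fans are built. Bounded disjoint reserves prevent this. They exist
  however many heavy pairs there are, because a single vertex sees only boundedly many hubs and
  reserved vertices.\<close>

definition touch :: "('a \<Rightarrow> 'a \<Rightarrow> bool) \<Rightarrow> 'a set \<Rightarrow> 'a set \<Rightarrow> bool" where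
  "touch E A B \<longleftrightarrow> (\<exists>x \<in> A. \<exists>y \<in> B. E x y)"

abbreviation restr :: "('a \<Rightarrow> 'a \<Rightarrow> bool) \<Rightarrow> 'a set \<Rightarrow> 'a \<Rightarrow> 'a \<Rightarrow> bool" where
  "restr E B \<equiv> (\<lambda>u v. u \<in> B \<and> v \<in> B \<and> E u v)"

text \<open>Connectivity is stated for bare relations because contractions, the quotient and its
  subgraphs occur below only as relations; \<open>connected_induce\<close> translates back to the
  library notion.\<close>

definition conn :: "('a \<Rightarrow> 'a \<Rightarrow> bool) \<Rightarrow> 'a set \<Rightarrow> bool" where
  "conn E B \<longleftrightarrow> B \<noteq> {} \<and> (\<forall>x \<in> B. \<forall>y \<in> B. (restr E B)\<^sup>*\<^sup>* x y)"

lemma rtranclp_step_rtranclp: "R\<^sup>*\<^sup>* a b \<Longrightarrow> R b c \<Longrightarrow> R\<^sup>*\<^sup>* c d \<Longrightarrow> R\<^sup>*\<^sup>* a d"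
  by (rule rtranclp_trans[OF rtranclp.rtrancl_into_rtrancl])

lemma touch_sym: "symp E \<Longrightarrow> touch E A B \<Longrightarrow> touch E B A"
  unfolding touch_def by (meson sympD)

lemma touch_mono: "touch E A B \<Longrightarrow> A \<subseteq> A' \<Longrightarrow> B \<subseteq> B' \<Longrightarrow> touch E A' B'"
  unfolding touch_def by blast

lemma conn_singleton [simp]: "conn E {x}"
  by (simp add: conn_def)

lemma conn_reach:
  assumes "conn E A" "A \<subseteq> B" "x \<in> A" "y \<in> A"
  shows "(restr E B)\<^sup>*\<^sup>* x y"
proof -
  have "(restr E A)\<^sup>*\<^sup>* x y"
    using assms unfolding conn_def by blast
  then show ?thesis
    by (rule rtranclp_mono[THEN predicate2D, rotated]) (use assms(2) in auto)
qed

lemma conn_rootI: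
  assumes "symp E" "r \<in> B" "\<And>y. y \<in> B \<Longrightarrow> (restr E B)\<^sup>*\<^sup>* r y"
  shows "conn E B"
proof -
  have "symp (restr E B)"
    using assms(1) by (auto intro!: sympI dest: sympD)
  then have "symp ((restr E B)\<^sup>*\<^sup>*)"
    by (rule symp_rtranclp)
  then show ?thesis
    unfolding conn_def using assms(2,3) by (blast intro: rtranclp_trans dest: sympD)
qed

lemma conn_attach:
  assumes "symp E" "conn E U" "\<And>i. i \<in> I \<Longrightarrow> conn E (Z i) \<and> touch E U (Z i)"
  shows "conn E (U \<union> (\<Union>i\<in>I. Z i))"
proof -
  let ?B = "U \<union> (\<Union>i\<in>I. Z i)"
  obtain r where r: "r \<in> U"
    using assms(2) unfolding conn_def by blast
  show ?thesis
  proof (rule conn_rootI[OF assms(1)])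
    show "r \<in> ?B" using r by blast
    fix y assume "y \<in> ?B"
    then consider "y \<in> U" | i where "i \<in> I" "y \<in> Z i" by blast
    then show "(restr E ?B)\<^sup>*\<^sup>* r y"
    proof cases
      case 1
      then show ?thesis using conn_reach[OF assms(2) _ r] by blast
    next
      case 2
      then obtain u z where uz: "u \<in> U" "z \<in> Z i" "E u z"
        using assms(3) unfolding touch_def by blast
      have "(restr E ?B)\<^sup>*\<^sup>* r u"
        using conn_reach[OF assms(2) _ r uz(1)] by blast
      moreover have "(restr E ?B) u z" using uz 2 by blast
      moreover have "(restr E ?B)\<^sup>*\<^sup>* z y"
        using conn_reach[of E "Z i" ?B z y] assms(3) 2 uz by blast
      ultimately show ?thesis by (rule rtranclp_step_rtranclp)
    qed
  qed
qed

lemma conn_attach_points: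
  assumes "symp E" "conn E U" "\<And>y. y \<in> Y \<Longrightarrow> \<exists>u\<in>U. E u y"
  shows "conn E (U \<union> Y)"
  using conn_attach[OF assms(1,2), of Y "\<lambda>y. {y}"] assms(3) by (auto simp: touch_def)

text \<open>Walks in \<open>F\<close> lift step by step: an \<open>F\<close>-edge supplies one
  \<open>E\<close>-edge between two bags, and connectivity inside the bags joins consecutive
  ones.\<close>

lemma conn_blow_up:
  assumes "symp E" "conn F X"
    and b: "\<And>x. x \<in> X \<Longrightarrow> conn E (b x)"
    and F: "\<And>x y. x \<in> X \<Longrightarrow> y \<in> X \<Longrightarrow> F x y \<Longrightarrow> touch E (b x) (b y)"
  shows "conn E (\<Union>x\<in>X. b x)"
proof -
  let ?B = "\<Union>x\<in>X. b x"
  obtain x0 r where r: "x0 \<in> X" "r \<in> b x0"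
    using assms(2) b unfolding conn_def by blast
  show ?thesis
  proof (rule conn_rootI[OF assms(1)])
    show "r \<in> ?B" using r by blast
    fix y assume "y \<in> ?B"
    then obtain x where x: "x \<in> X" "y \<in> b x" by blast
    have "(restr F X)\<^sup>*\<^sup>* x0 x" using assms(2) r x unfolding conn_def by blast
    then have "\<forall>y\<in>b x. (restr E ?B)\<^sup>*\<^sup>* r y"
    proof (induction rule: rtranclp_induct)
      case base
      then show ?case using conn_reach[of E "b x0" ?B r] r b by blast
    next
      case (step u v)
      then obtain p q where pq: "p \<in> b u" "q \<in> b v" "E p q"
        using F unfolding touch_def by blast
      show ?case
      proof
        fix z assume "z \<in> b v"
        then have "(restr E ?B)\<^sup>*\<^sup>* q z" using conn_reach[of E "b v" ?B q z] step pq b by blast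
        moreover have "(restr E ?B)\<^sup>*\<^sup>* r p" using step pq by blast
        moreover have "(restr E ?B) p q" using step pq by blast
        ultimately show "(restr E ?B)\<^sup>*\<^sup>* r z"
          using rtranclp_step_rtranclp[of "restr E ?B" r p q z] by blast
      qed
    qed
    then show "(restr E ?B)\<^sup>*\<^sup>* r y" using x by blast
  qed
qed

text \<open>
  The fan is the join of a vertex with \<open>k\<close> disjoint stars with \<open>k\<close> leaves each. Its apex is
  \<open>(0, 0)\<close>, the centre of star \<open>i\<close> is \<open>(Suc i, 0)\<close> and the leaves of that star are
  \<open>(Suc i, Suc l)\<close>; \<open>has_fan\<close> asks for the fan as a minor.
\<close>

definition fan_verts :: "nat \<Rightarrow> (nat \<times> nat) set" where
  "fan_verts k = {(0, 0)} \<union> (\<lambda>i. (Suc i, 0)) ` {..<k} \<union> (\<lambda>(i, l). (Suc i, Suc l)) ` ({..<k} \<times> {..<k})"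

definition has_fan :: "nat \<Rightarrow> 'a set \<Rightarrow> ('a \<Rightarrow> 'a \<Rightarrow> bool) \<Rightarrow> bool" where
  "has_fan k V E \<longleftrightarrow>
     (\<exists>B. (\<forall>p \<in> fan_verts k. B p \<subseteq> V \<and> conn E (B p)) \<and> disjoint_family_on B (fan_verts k) \<and>
        (\<forall>i<k. touch E (B (0, 0)) (B (Suc i, 0)) \<and>
           (\<forall>l<k. touch E (B (0, 0)) (B (Suc i, Suc l)) \<and> touch E (B (Suc i, 0)) (B (Suc i, Suc l)))))"

lemma fan_vertsI:
  "(0, 0) \<in> fan_verts k"
  "i < k \<Longrightarrow> (Suc i, 0) \<in> fan_verts k"
  "i < k \<Longrightarrow> l < k \<Longrightarrow> (Suc i, Suc l) \<in> fan_verts k"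
  by (auto simp: fan_verts_def image_iff)

text \<open>Minors compose: each branch set is replaced by the union of its bags. This serves for
  single edge contractions as well as for the contraction of whole components.\<close>

lemma has_fan_blow_up:
  assumes "symp E" "has_fan k X F" and disj: "disjoint_family_on b X"
    and b: "\<And>x. x \<in> X \<Longrightarrow> b x \<subseteq> V \<and> conn E (b x)"
    and F: "\<And>x y. x \<in> X \<Longrightarrow> y \<in> X \<Longrightarrow> F x y \<Longrightarrow> touch E (b x) (b y)"
  shows "has_fan k V E"
proof -
  obtain B where B: "\<And>p. p \<in> fan_verts k \<Longrightarrow> B p \<subseteq> X \<and> conn F (B p)"
    and dB: "disjoint_family_on B (fan_verts k)"
    and t: "\<And>i. i < k \<Longrightarrow> touch F (B (0, 0)) (B (Suc i, 0))"
      "\<And>i l. i < k \<Longrightarrow> l < k \<Longrightarrow> touch F (B (0, 0)) (B (Suc i, Suc l))"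
      "\<And>i l. i < k \<Longrightarrow> l < k \<Longrightarrow> touch F (B (Suc i, 0)) (B (Suc i, Suc l))"
    using assms(2) unfolding has_fan_def by blast
  define B' where "B' = (\<lambda>p. \<Union>x\<in>B p. b x)"
  have "B' p \<subseteq> V \<and> conn E (B' p)" if "p \<in> fan_verts k" for p
    unfolding B'_def using B[OF that] b by (blast intro!: conn_blow_up[OF assms(1)] F)
  moreover have "disjoint_family_on B' (fan_verts k)"
    unfolding disjoint_family_on_def
  proof (intro ballI impI)
    fix p q assume pq: "p \<in> fan_verts k" "q \<in> fan_verts k" "p \<noteq> q"
    then have "B p \<inter> B q = {}" "B p \<subseteq> X" "B q \<subseteq> X"
      using dB B unfolding disjoint_family_on_def by blast+
    then show "B' p \<inter> B' q = {}"
      unfolding B'_def using disjoint_family_onD[OF disj] by (simp add: disjoint_iff subset_iff) metis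
  qed
  moreover have tt: "touch E (B' p) (B' q)"
    if that': "p \<in> fan_verts k" "q \<in> fan_verts k" "touch F (B p) (B q)" for p q
  proof -
    obtain x y where xy: "x \<in> B p" "y \<in> B q" "F x y" using that'(3) unfolding touch_def by blast
    then have "touch E (b x) (b y)" using B[OF that'(1)] B[OF that'(2)] F[of x y] by blast
    then show ?thesis by (rule touch_mono) (use xy in \<open>auto simp: B'_def\<close>)
  qed
  ultimately show ?thesis
    unfolding has_fan_def by (intro exI[of _ B'] conjI ballI allI impI) (simp_all add: tt fan_vertsI t)
qed

section \<open>Greedy choices and the assembly of fans\<close>

lemma disjoint_selection:
  assumes "finite I" "\<And>i. i \<in> I \<Longrightarrow> n * card I \<le> card (A i) \<and> finite (A i)"
  obtains D where "\<And>i. i \<in> I \<Longrightarrow> D i \<subseteq> A i \<and> card (D i) = n" "disjoint_family_on D I"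
proof -
  have "\<exists>D. (\<forall>i\<in>I. D i \<subseteq> A i \<and> card (D i) = n) \<and> disjoint_family_on D I"
    using assms
  proof (induction I rule: finite_induct)
    case empty
    then show ?case by (simp add: disjoint_family_on_def)
  next
    case (insert j I)
    have "\<exists>D. (\<forall>i\<in>I. D i \<subseteq> A i \<and> card (D i) = n) \<and> disjoint_family_on D I"
    proof (rule insert.IH)
      fix i assume "i \<in> I"
      then have "n * card (insert j I) \<le> card (A i)" "finite (A i)" using insert.prems by blast+
      then show "n * card I \<le> card (A i) \<and> finite (A i)"
        using insert.hyps by simp
    qed
    then obtain D where D: "\<forall>i\<in>I. D i \<subseteq> A i \<and> card (D i) = n" "disjoint_family_on D I" by blast
    let ?U = "\<Union>i\<in>I. D i"
    have fin: "finite ?U"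
      using D insert.prems insert.hyps(1) by (meson finite_UN finite_subset insertCI)
    have "card ?U \<le> (\<Sum>i\<in>I. card (D i))" by (rule card_UN_le[OF insert.hyps(1)])
    also have "\<dots> = n * card I" using D by simp
    finally have "card ?U \<le> n * card I" .
    moreover have "n * card I + n \<le> card (A j)" "finite (A j)"
      using insert.prems[of j] insert.hyps by auto
    moreover have "card (A j) - card ?U \<le> card (A j - ?U)"
      by (rule diff_card_le_card_Diff[OF fin])
    ultimately have "n \<le> card (A j - ?U)" by linarith
    then obtain C where C: "C \<subseteq> A j - ?U" "card C = n"
      by (meson obtain_subset_with_card_n)
    have "\<forall>i\<in>insert j I. (D(j := C)) i \<subseteq> A i \<and> card ((D(j := C)) i) = n"
      using C D by auto
    moreover have "disjoint_family_on (D(j := C)) (insert j I)"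
      using D(2) C insert.hyps(2) unfolding disjoint_family_on_def by (auto simp: disjoint_iff)
    ultimately show ?case by blast
  qed
  then show ?thesis using that by blast
qed

text \<open>One vertex of \<open>A i\<close> connects \<open>c i\<close> to \<open>U\<close>, the others become leaves.\<close>

lemma fanI:
  assumes "symp E" "finite V" "card I = k" "finite I"
    and U: "U \<subseteq> V" "conn E U"
    and c: "inj_on c I" "c ` I \<subseteq> V" "c ` I \<inter> U = {}"
    and A: "\<And>i. i \<in> I \<Longrightarrow> A i \<subseteq> V \<and> A i \<inter> U = {} \<and> A i \<inter> c ` I = {} \<and> k * (k + 1) \<le> card (A i)"
    and adj: "\<And>i x. i \<in> I \<Longrightarrow> x \<in> A i \<Longrightarrow> E (c i) x \<and> (\<exists>u\<in>U. E u x)"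
  shows "has_fan k V E"
proof -
  have "\<And>i. i \<in> I \<Longrightarrow> (k + 1) * card I \<le> card (A i) \<and> finite (A i)"
    using A assms(3) finite_subset[OF _ assms(2)] by (simp add: mult.commute)
  then obtain D where D: "\<And>i. i \<in> I \<Longrightarrow> D i \<subseteq> A i \<and> card (D i) = k + 1" "disjoint_family_on D I"
    using disjoint_selection[OF assms(4), of "k+1" A] by metis
  obtain \<iota> where \<iota>: "bij_betw \<iota> {..<k} I"
    using ex_bij_betw_nat_finite[OF assms(4)] assms(3) by (auto simp: atLeast0LessThan)
  have \<iota>I: "\<iota> i \<in> I" if "i < k" for i using \<iota> that by (auto simp: bij_betw_def)
  have \<iota>inj: "i = j" if "i < k" "j < k" "\<iota> i = \<iota> j" for i j
    using \<iota> that by (auto simp: bij_betw_def inj_on_def)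
  have "\<exists>d. bij_betw d {..<k+1} (D i)" if "i \<in> I" for i
    using ex_bij_betw_nat_finite[of "D i"] D(1)[OF that] by (metis atLeast0LessThan card.infinite add_is_0 one_neq_zero)
  then obtain d where d: "\<And>i. i \<in> I \<Longrightarrow> bij_betw (d i) {..<k+1} (D i)" by metis
  have dD: "d i l \<in> D i" if "i \<in> I" "l \<le> k" for i l
    using d[OF that(1)] that(2) by (auto simp: bij_betw_def)
  have dinj: "l = l'" if "i \<in> I" "l \<le> k" "l' \<le> k" "d i l = d i l'" for i l l'
    using d[OF that(1)] that by (auto simp: bij_betw_def inj_on_def)
  \<comment> \<open>The indices \<open>l < k\<close> of \<open>d\<close> are the leaves; index
    \<open>k\<close> is the extra vertex that joins the centre to \<open>U\<close> and shares the
    branch set of the centre.\<close>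
  define B where "B = (\<lambda>p. case p of (0, _) \<Rightarrow> U | (Suc i, 0) \<Rightarrow> {c (\<iota> i), d (\<iota> i) k}
     | (Suc i, Suc l) \<Rightarrow> {d (\<iota> i) l})"
  have B: "B (0, 0) = U" "\<And>i. B (Suc i, 0) = {c (\<iota> i), d (\<iota> i) k}" "\<And>i l. B (Suc i, Suc l) = {d (\<iota> i) l}"
    by (auto simp: B_def)
  have dA: "d (\<iota> i) l \<in> A (\<iota> i)" if "i < k" "l \<le> k" for i l
    using dD[OF \<iota>I[OF that(1)] that(2)] D \<iota>I[OF that(1)] by blast
  have adjd: "E (c (\<iota> i)) (d (\<iota> i) l)" "\<exists>u\<in>U. E u (d (\<iota> i) l)" if "i < k" "l \<le> k" for i l
    using adj[OF \<iota>I[OF that(1)] dA[OF that]] by auto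
  have dV: "d (\<iota> i) l \<in> V" "d (\<iota> i) l \<notin> U" "d (\<iota> i) l \<notin> c ` I" if "i < k" "l \<le> k" for i l
    using A[OF \<iota>I[OF that(1)]] dA[OF that] by blast+
  have cV: "c (\<iota> i) \<in> V" "c (\<iota> i) \<notin> U" if "i < k" for i
    using c \<iota>I[OF that] by blast+
  have dneq: "i = i' \<and> l = l'" if "i < k" "i' < k" "l \<le> k" "l' \<le> k" "d (\<iota> i) l = d (\<iota> i') l'" for i i' l l'
  proof -
    have "d (\<iota> i) l \<in> D (\<iota> i)" "d (\<iota> i) l \<in> D (\<iota> i')"
      using dD \<iota>I that by metis+
    then have "\<iota> i = \<iota> i'"
      using D(2) \<iota>I that unfolding disjoint_family_on_def by blast
    then show ?thesis using \<iota>inj dinj \<iota>I that by metis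
  qed
  have cneq: "i = i'" if "i < k" "i' < k" "c (\<iota> i) = c (\<iota> i')" for i i'
    using c(1) \<iota>I \<iota>inj that unfolding inj_on_def by blast
  have cd: "c (\<iota> i) \<noteq> d (\<iota> i') l" if "i < k" "i' < k" "l \<le> k" for i i' l
    using dV(3)[OF that(2,3)] \<iota>I[OF that(1)] by (metis imageI)
  have cneq_iff: "c (\<iota> i) = c (\<iota> i') \<longleftrightarrow> i = i'" if "i < k" "i' < k" for i i'
    using cneq that by blast
  have dneq_iff: "d (\<iota> i) l = d (\<iota> i') l' \<longleftrightarrow> i = i' \<and> l = l'"
    if "i < k" "i' < k" "l \<le> k" "l' \<le> k" for i i' l l'
    using dneq that by blast
  have conn2: "conn E {x, y}" if "E x y" for x y
    using conn_attach_points[OF assms(1), of "{x}" "{y}"] that by (simp add: insert_commute)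
  have fv: "(\<exists>i<k. p = (Suc i, 0)) \<or> (\<exists>i<k. \<exists>l<k. p = (Suc i, Suc l)) \<or> p = (0,0)" if "p \<in> fan_verts k" for p
    using that by (auto simp: fan_verts_def)
  show ?thesis
    unfolding has_fan_def
  proof (intro exI[of _ B] conjI ballI allI impI)
    fix p assume p: "p \<in> fan_verts k"
    show "B p \<subseteq> V"
      using fv[OF p] U cV dV by (auto simp: B)
    show "conn E (B p)"
      using fv[OF p] U conn2 adjd by (auto simp: B)
  next
    show "disjoint_family_on B (fan_verts k)"
      unfolding disjoint_family_on_def
    proof (intro ballI impI)
      fix p q assume pq: "p \<in> fan_verts k" "q \<in> fan_verts k" "p \<noteq> q"
      have "p = q" if x: "x \<in> B p" "x \<in> B q" for x
        using fv[OF pq(1)] fv[OF pq(2)] x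
        by (elim disjE exE conjE) (simp_all add: B, (auto simp: cV dV cd cd[symmetric] cneq_iff dneq_iff)+)
      then show "B p \<inter> B q = {}" using pq(3) by blast
    qed
  next
    fix i assume i: "i < k"
    show "touch E (B (0, 0)) (B (Suc i, 0))"
      using adjd(2)[OF i order_refl] by (auto simp: B touch_def)
    fix l assume l: "l < k"
    then show "touch E (B (0, 0)) (B (Suc i, Suc l))"
      using adjd(2)[OF i, of l] by (auto simp: B touch_def)
    show "touch E (B (Suc i, 0)) (B (Suc i, Suc l))"
      using adjd(1)[OF i, of l] l by (auto simp: B touch_def)
  qed
qed

text \<open>\<open>U\<close>, \<open>Y\<close> and \<open>X\<close> all go into the apex, so the
  centre \<open>p x\<close> reaches the apex through any common neighbour with \<open>x\<close>;
  \<open>Y\<close> helps to attach \<open>X\<close> to \<open>U\<close>. Removing \<open>X\<close>,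
  its image under \<open>p\<close> and \<open>Y\<close> costs at most \<open>3 * k\<close>
  candidates, which leaves the \<open>k * (k + 1)\<close> that \<open>fanI\<close> demands.\<close>

lemma fan_builder:
  assumes "symp E" "finite V" "card X = k" "k > 0"
    and U: "U \<subseteq> V" "conn E U"
    and X: "X \<subseteq> V" "X \<inter> U = {}"
    and p: "inj_on p X" "p ` X \<subseteq> V" "p ` X \<inter> U = {}" "p ` X \<inter> X = {}"
    and Y: "Y \<subseteq> V" "card Y \<le> k" "Y \<inter> X = {}" "Y \<inter> p ` X = {}"
    and YU: "\<And>y. y \<in> Y \<Longrightarrow> \<exists>u\<in>U. E u y"
    and XU: "\<And>x. x \<in> X \<Longrightarrow> \<exists>u\<in>U \<union> Y. E u x"
    and A: "\<And>x. x \<in> X \<Longrightarrow> A x \<subseteq> V \<and> A x \<inter> U = {} \<and> 3 * k + k * (k + 1) \<le> card (A x)"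
    and adj: "\<And>x a. x \<in> X \<Longrightarrow> a \<in> A x \<Longrightarrow> E x a \<and> E (p x) a"
  shows "has_fan k V E"
proof (rule fanI[OF assms(1,2,3), where U = "U \<union> Y \<union> X" and c = p and A = "\<lambda>x. A x - (X \<union> p ` X \<union> Y)"])
  show fX: "finite X" using assms(3,4) card_gt_0_iff by metis
  have fY: "finite Y" using Y(1) assms(2) finite_subset by blast
  show "conn E (U \<union> Y \<union> X)"
    using conn_attach_points[OF assms(1) conn_attach_points[OF assms(1) U(2) YU] XU] by blast
  show "U \<union> Y \<union> X \<subseteq> V" using U X Y by blast
  show "inj_on p X" "p ` X \<subseteq> V" by fact+
  show "p ` X \<inter> (U \<union> Y \<union> X) = {}" using p Y by blast
  fix x assume x: "x \<in> X"
  have "card (X \<union> p ` X \<union> Y) \<le> 3 * k"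
  proof -
    have "card (X \<union> p ` X \<union> Y) \<le> card X + card (p ` X) + card Y"
      by (meson add_le_mono card_Un_le le_refl le_trans)
    moreover have "card (p ` X) \<le> card X" by (rule card_image_le[OF fX])
    ultimately show ?thesis using assms(3) Y(2) by linarith
  qed
  moreover have "card (A x) - card (X \<union> p ` X \<union> Y) \<le> card (A x - (X \<union> p ` X \<union> Y))"
    by (rule diff_card_le_card_Diff) (use fX fY in auto)
  ultimately have "k * (k + 1) \<le> card (A x - (X \<union> p ` X \<union> Y))" using A[OF x] by linarith
  then show "A x - (X \<union> p ` X \<union> Y) \<subseteq> V \<and> (A x - (X \<union> p ` X \<union> Y)) \<inter> (U \<union> Y \<union> X) = {} \<and>
     (A x - (X \<union> p ` X \<union> Y)) \<inter> p ` X = {} \<and> k * (k + 1) \<le> card (A x - (X \<union> p ` X \<union> Y))"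
    using A[OF x] by blast
  fix a assume "a \<in> A x - (X \<union> p ` X \<union> Y)"
  then show "E (p x) a \<and> (\<exists>u\<in>U \<union> Y \<union> X. E u a)" using adj x by blast
qed

text \<open>Greedy: a chosen element rules out at most \<open>c\<close> elements, itself included
  since \<open>R\<close> is reflexive on \<open>X\<close>.\<close>

lemma independent_selection:
  assumes "finite X" "symp R" "\<And>x. x \<in> X \<Longrightarrow> R x x \<and> card {y \<in> X. R x y} \<le> c" "n * c \<le> card X"
    "0 < c"
  obtains Z where "Z \<subseteq> X" "card Z = n" "\<And>x y. x \<in> Z \<Longrightarrow> y \<in> Z \<Longrightarrow> x \<noteq> y \<Longrightarrow> \<not> R x y"
proof -
  have "\<exists>Z\<subseteq>X. card Z = n \<and> (\<forall>x\<in>Z. \<forall>y\<in>Z. x \<noteq> y \<longrightarrow> \<not> R x y)"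
    using assms(1,3,4)
  proof (induction n arbitrary: X)
    case 0
    then show ?case by (intro exI[of _ "{}"]) auto
  next
    case (Suc n)
    have "c \<le> card X" using Suc.prems(3) unfolding mult_Suc by linarith
    then have "X \<noteq> {}" using assms(5) by (metis card.empty less_le_not_le)
    then obtain x where x: "x \<in> X" by blast
    let ?X = "X - {y \<in> X. R x y}"
    have c: "card {y \<in> ?X. R z y} \<le> c" if "z \<in> X" for z
      using card_mono[of "{y \<in> X. R z y}" "{y \<in> ?X. R z y}"] Suc.prems(1,2) that by (auto intro: le_trans)
    have "card X - card {y \<in> X. R x y} \<le> card ?X"
      by (rule diff_card_le_card_Diff) (use Suc.prems in auto)
    then have "n * c \<le> card ?X" using Suc.prems(2)[OF x] Suc.prems(3) unfolding mult_Suc by linarith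
    then obtain Z where Z: "Z \<subseteq> ?X" "card Z = n" "\<forall>x\<in>Z. \<forall>y\<in>Z. x \<noteq> y \<longrightarrow> \<not> R x y"
      using Suc.IH[of ?X] Suc.prems c by auto
    have "finite Z" using finite_subset[OF Z(1)] Suc.prems(1) by simp
    moreover have "x \<notin> Z" using Z(1) Suc.prems(2)[OF x] x by blast
    ultimately have "card (insert x Z) = Suc n" using Z by simp
    moreover have "insert x Z \<subseteq> X" using Z x by blast
    moreover have "\<forall>u\<in>insert x Z. \<forall>y\<in>insert x Z. u \<noteq> y \<longrightarrow> \<not> R u y"
      using Z sympD[OF assms(2)] by blast
    ultimately show ?case by blast
  qed
  then show ?thesis using that by blast
qed

section \<open>Edge density forces a fan minor\<close>

definition arcs_in :: "'a set \<Rightarrow> ('a \<Rightarrow> 'a \<Rightarrow> bool) \<Rightarrow> ('a \<times> 'a) set" where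
  "arcs_in V E = {(x, y). x \<in> V \<and> y \<in> V \<and> E x y}"

lemma finite_arcs_in: "finite V \<Longrightarrow> finite (arcs_in V E)"
  unfolding arcs_in_def by (rule finite_subset[of _ "V \<times> V"]) auto

text \<open>
  Contract edges that lie in few triangles, which preserves the density. If every edge lies in many
  triangles, then the neighbourhood of any non-isolated vertex has large minimum degree and contains
  the stars greedily.
\<close>

lemma dense_has_fan:
  assumes "finite V" "symp E" "\<And>x. \<not> E x x" "V \<noteq> {}" "0 < k"
    and "2 * (k * (k + 2)) * card V \<le> card (arcs_in V E)"
  shows "has_fan k V E"
  using assms
proof (induction "card V" arbitrary: V E rule: less_induct)
  case less
  \<comment> \<open>This is \<open>k * (k + 1)\<close> candidates per centre for
    \<open>fanI\<close>, plus the \<open>k\<close> centres that are removed from each common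
    neighbourhood.\<close>
  let ?D = "k * (k + 2)"
  note sym = sympD[OF less.prems(2)]
  define com where "com = (\<lambda>x y. {z \<in> V. E x z \<and> E y z})"
  have fcom: "finite (com x y)" for x y using less.prems(1) by (auto simp: com_def)
  show ?case
  proof (cases "\<exists>x\<in>V. \<exists>y\<in>V. E x y \<and> card (com x y) < ?D")
    case True
    then obtain x y where xy: "x \<in> V" "y \<in> V" "E x y" "card (com x y) < ?D" by blast
    have neq: "x \<noteq> y" using xy less.prems(3) by auto
    let ?V = "V - {y}"
    define E' where "E' = (\<lambda>u v. u \<noteq> v \<and> (E u v \<or> u = x \<and> E y v \<or> v = x \<and> E u y))"
    have symE': "symp E'" unfolding E'_def using sym by (auto intro!: sympI)
    define P where "P = {z \<in> V. E y z \<and> z \<noteq> x \<and> \<not> E x z}"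
    have fP: "finite P" using less.prems(1) by (auto simp: P_def)
    have finV: "finite ?V" using less.prems(1) by simp
    define d where "d = card {z \<in> V. E y z}"
    \<comment> \<open>Contracting \<open>y\<close> into \<open>x\<close> hands the neighbours in
      \<open>P\<close> over to \<open>x\<close>. Only the contracted edge and one edge per common
      neighbour are lost: at most \<open>2 * ?D\<close> arcs for one vertex less.\<close>
    have d: "d = card P + card (com x y) + 1"
    proof -
      have "{z \<in> V. E y z} = insert x (P \<union> com x y)"
        using xy sym unfolding P_def com_def by auto
      moreover have "x \<notin> P \<union> com x y" using less.prems(3) by (auto simp: P_def com_def)
      moreover have "P \<inter> com x y = {}" by (auto simp: P_def com_def)
      ultimately show ?thesis unfolding d_def using fP fcom by (simp add: card_Un_disjoint)
    qed
    have arcsV: "card (arcs_in V E) = card (arcs_in ?V E) + 2 * d"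
    proof -
      let ?Y = "{z \<in> V. E y z}"
      have "arcs_in V E = arcs_in ?V E \<union> (Pair y ` ?Y \<union> (\<lambda>z. (z, y)) ` ?Y)"
        using xy sym less.prems(3) by (auto simp: arcs_in_def)
      moreover have "arcs_in ?V E \<inter> (Pair y ` ?Y \<union> (\<lambda>z. (z, y)) ` ?Y) = {}"
        by (auto simp: arcs_in_def)
      moreover have "Pair y ` ?Y \<inter> (\<lambda>z. (z, y)) ` ?Y = {}" using less.prems(3) by auto
      moreover have "card (Pair y ` ?Y) = d" "card ((\<lambda>z. (z, y)) ` ?Y) = d"
        unfolding d_def by (auto intro!: card_image simp: inj_on_def)
      ultimately show ?thesis
        using finite_arcs_in[OF finV, of E] less.prems(1) by (simp add: card_Un_disjoint)
    qed
    have arcsV': "card (arcs_in ?V E) + 2 * card P \<le> card (arcs_in ?V E')"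
    proof -
      have sub: "arcs_in ?V E \<union> (Pair x ` P \<union> (\<lambda>z. (z, x)) ` P) \<subseteq> arcs_in ?V E'"
        using xy neq sym less.prems(3) unfolding arcs_in_def P_def E'_def by auto
      moreover have "arcs_in ?V E \<inter> (Pair x ` P \<union> (\<lambda>z. (z, x)) ` P) = {}"
        using sym by (auto simp: arcs_in_def P_def)
      moreover have "Pair x ` P \<inter> (\<lambda>z. (z, x)) ` P = {}" by (auto simp: P_def)
      moreover have "card (Pair x ` P) = card P" "card ((\<lambda>z. (z, x)) ` P) = card P"
        by (auto intro!: card_image simp: inj_on_def)
      moreover have "card (arcs_in ?V E \<union> (Pair x ` P \<union> (\<lambda>z. (z, x)) ` P)) \<le> card (arcs_in ?V E')"
        by (rule card_mono[OF finite_arcs_in[OF finV] sub])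
      ultimately show ?thesis
        using finite_arcs_in[OF finV, of E] fP by (simp add: card_Un_disjoint)
    qed
    have cV: "card V = card ?V + 1" using xy less.prems(1)
      by (metis Suc_eq_plus1 card.remove)
    have "2 * ?D * card ?V \<le> card (arcs_in ?V E')"
    proof -
      have "2 * ?D * card ?V + 2 * ?D \<le> card (arcs_in ?V E) + 2 * d"
        using less.prems(6) arcsV cV by (simp add: algebra_simps)
      moreover have "d \<le> card P + ?D" using d xy(4) by simp
      ultimately show ?thesis using arcsV' by linarith
    qed
    moreover have "?V \<noteq> {}" using xy neq by blast
    moreover have "\<And>x. \<not> E' x x" by (simp add: E'_def)
    ultimately have fan: "has_fan k ?V E'"
      using less.hyps[of ?V E'] cV finV symE' less.prems(5) by simp
    show ?thesis
    proof (rule has_fan_blow_up[OF less.prems(2) fan, where b = "\<lambda>z. if z = x then {x, y} else {z}"])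
      show "disjoint_family_on (\<lambda>z. if z = x then {x, y} else {z}) ?V"
        by (auto simp: disjoint_family_on_def)
      have "conn E {x, y}"
        using conn_attach_points[OF less.prems(2), of "{x}" "{y}"] xy by (simp add: insert_commute)
      then show "(if z = x then {x, y} else {z}) \<subseteq> V \<and> conn E (if z = x then {x, y} else {z})"
        if "z \<in> ?V" for z using that xy by auto
    next
      fix u v assume "u \<in> ?V" "v \<in> ?V" "E' u v"
      then show "touch E (if u = x then {x, y} else {u}) (if v = x then {x, y} else {v})"
        unfolding touch_def E'_def by auto
    qed
  next
    case False
    have "0 < card V" using less.prems(1,4) card_gt_0_iff by blast
    then have "0 < 2 * ?D * card V" using less.prems(5) by simp
    then have "arcs_in V E \<noteq> {}"
      using less.prems(6) by fastforce
    then obtain x y where xy: "x \<in> V" "y \<in> V" "E x y" by (auto simp: arcs_in_def)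
    let ?N = "{z \<in> V. E x z}"
    have big: "?D \<le> card (com x z)" if "z \<in> ?N" for z using False that xy(1) by force
    have "k \<le> ?D" by simp
    also have "\<dots> \<le> card ?N"
    proof -
      have "com x y \<subseteq> ?N" by (auto simp: com_def)
      then have "card (com x y) \<le> card ?N"
        by (rule card_mono[rotated]) (use less.prems(1) in auto)
      then show ?thesis using big[of y] xy by simp
    qed
    finally obtain I where I: "I \<subseteq> ?N" "card I = k" "finite I" by (meson obtain_subset_with_card_n)
    show ?thesis
    proof (rule fanI[OF less.prems(2,1) I(2,3), of "{x}" "\<lambda>z. z" "\<lambda>z. com x z - I"])
      show "(\<lambda>z. z) ` I \<inter> {x} = {}" using I less.prems(3) by auto
      fix z assume z: "z \<in> I"
      have "card (com x z) - card I \<le> card (com x z - I)"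
        by (rule diff_card_le_card_Diff[OF I(3)])
      then have "k * (k + 1) \<le> card (com x z - I)" using big[of z] z I by auto
      then show "com x z - I \<subseteq> V \<and> (com x z - I) \<inter> {x} = {} \<and> (com x z - I) \<inter> (\<lambda>z. z) ` I = {} \<and> k * (k + 1) \<le> card (com x z - I)"
        using less.prems(3) by (auto simp: com_def)
    next
      fix z a assume "z \<in> I" "a \<in> com x z - I"
      then show "E z a \<and> (\<exists>u\<in>{x}. E u a)" by (auto simp: com_def)
    qed (use I xy in auto)
  qed
qed


section \<open>Heavy pairs\<close>

text \<open>\<open>leaf_supply\<close> is the demand of \<open>fan_builder\<close>. A heavy pair
  shares an end with at most \<open>2 * k + 2\<close> of the pairs in \<open>matching_fan\<close>,
  itself included, so \<open>matching_size\<close> many contain \<open>k\<close> disjoint ones.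
  \<open>hub_degree\<close> adds the heavy partners of the vertex itself.
  \<open>reserve_size\<close> allows for one lost vertex (see \<open>D_inter_bag\<close>).
  \<open>conflict_bound\<close> sums the reserves of pairs at a vertex and of pairs elsewhere.
  \<open>heavy_bound\<close> leaves a full reserve once hubs and conflicts are discarded, and
  \<open>leaf_supply\<close> many common neighbours once a single vertex is.\<close>

definition leaf_supply :: "nat \<Rightarrow> nat" where "leaf_supply k = 3 * k + k * (k + 1)"
definition matching_size :: "nat \<Rightarrow> nat" where "matching_size k = k * (2 * k + 2)"
definition hub_degree :: "nat \<Rightarrow> nat" where "hub_degree k = matching_size k + k"
definition reserve_size :: "nat \<Rightarrow> nat" where "reserve_size k = leaf_supply k + 1"
definition conflict_bound :: "nat \<Rightarrow> nat" where "conflict_bound k = k * reserve_size k + matching_size k * (k * reserve_size k)"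
definition heavy_bound :: "nat \<Rightarrow> nat" where "heavy_bound k = hub_degree k + conflict_bound k + reserve_size k + leaf_supply k + 1"

locale fan_free =
  fixes V :: "'a set" and E :: "'a \<Rightarrow> 'a \<Rightarrow> bool" and k :: nat
  assumes finV: "finite V" and symE: "symp E" and irrE: "\<not> E x x"
    and EV: "E x y \<Longrightarrow> x \<in> V \<and> y \<in> V"
    and k_pos: "0 < k" and no_fan: "\<not> has_fan k V E"
begin

lemma E_sym: "E x y \<Longrightarrow> E y x"
  using symE by (rule sympD)

definition com :: "'a \<Rightarrow> 'a \<Rightarrow> 'a set" where
  "com a b = {x. E a x \<and> E b x}"

text \<open>
  Two vertices with more common neighbours than twice the defect are forced to have the same colour;
  here all heavy pairs will be coloured alike.
\<close>

definition heavy :: "'a \<Rightarrow> 'a \<Rightarrow> bool" where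
  "heavy a b \<longleftrightarrow> a \<noteq> b \<and> heavy_bound k \<le> card (com a b)"

definition hubs :: "'a set" where
  "hubs = {a. \<exists>b. heavy a b}"

lemma com_V: "com a b \<subseteq> V"
  using EV by (auto simp: com_def)

lemma finite_com: "finite (com a b)"
  using com_V finV finite_subset by blast

lemma com_commute: "com a b = com b a"
  by (auto simp: com_def)

lemma heavy_sym: "heavy a b \<Longrightarrow> heavy b a"
  by (auto simp: heavy_def com_commute)

lemma heavy_V: assumes "heavy a b" shows "a \<in> V" "b \<in> V"
proof -
  have "com a b \<noteq> {}" using assms by (auto simp: heavy_def heavy_bound_def)
  then show "a \<in> V" "b \<in> V" using EV by (auto simp: com_def)
qed

lemma hubs_V: "hubs \<subseteq> V"
  using heavy_V by (auto simp: hubs_def)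

lemma finite_hubs: "finite hubs"
  using hubs_V finV finite_subset by blast

lemma finite_heavy: "finite {b. heavy a b}"
  using heavy_V(2) finV by (auto intro: finite_subset)

text \<open>Otherwise \<open>k\<close> heavy partners of \<open>a\<close> are the centres of a fan
  with apex \<open>a\<close>, whose leaves are common neighbours with \<open>a\<close>.\<close>

lemma heavy_degree: "card {b. heavy a b} < k"
proof (rule ccontr)
  assume "\<not> card {b. heavy a b} < k"
  then obtain X where X: "X \<subseteq> {b. heavy a b}" "card X = k" "finite X"
    by (meson not_less obtain_subset_with_card_n)
  have "X \<noteq> {}" using X k_pos by auto
  then have a: "a \<in> V" using X heavy_V by blast
  have "has_fan k V E"
  proof (rule fanI[OF symE finV X(2,3), of "{a}" "\<lambda>b. b" "\<lambda>b. com a b - X"])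
    show "(\<lambda>b. b) ` X \<subseteq> V" "(\<lambda>b. b) ` X \<inter> {a} = {}" using X heavy_V by (auto simp: heavy_def)
    fix b assume b: "b \<in> X"
    have "card (com a b) - card X \<le> card (com a b - X)" by (rule diff_card_le_card_Diff[OF X(3)])
    moreover have "heavy_bound k \<le> card (com a b)" using X b by (auto simp: heavy_def)
    ultimately have "k * (k + 1) \<le> card (com a b - X)" using X(2) by (simp add: heavy_bound_def leaf_supply_def)
    then show "com a b - X \<subseteq> V \<and> (com a b - X) \<inter> {a} = {} \<and> (com a b - X) \<inter> (\<lambda>b. b) ` X = {} \<and>
         k * (k + 1) \<le> card (com a b - X)"
      using com_V irrE by (auto simp: com_def)
  next
    fix b x assume "b \<in> X" "x \<in> com a b - X"
    then show "E b x \<and> (\<exists>u\<in>{a}. E u x)" by (auto simp: com_def)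
  qed (use a in auto)
  then show False using no_fan by blast
qed

text \<open>
  The apex absorbs \<open>U\<close>, one end of each of \<open>k\<close> disjoint heavy pairs and the vertices \<open>y x\<close>; the
  other ends become the centres, and the leaves are common neighbours.
\<close>

lemma matching_fan:
  assumes U: "U \<subseteq> V" "conn E U"
    and X: "X \<inter> U = {}" "matching_size k \<le> card X"
    and p: "\<And>x. x \<in> X \<Longrightarrow> heavy x (p x) \<and> p x \<notin> U"
    and adj: "\<And>x. x \<in> X \<Longrightarrow> (\<exists>u\<in>U. E u x) \<or> (y x \<notin> hubs \<and> E (y x) x \<and> (\<exists>u\<in>U. E u (y x)))"
    and A: "\<And>x. x \<in> X \<Longrightarrow> A x \<subseteq> com x (p x) \<and> A x \<inter> U = {} \<and> leaf_supply k \<le> card (A x)"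
  shows False
proof -
  have XV: "X \<subseteq> V" using p heavy_V by blast
  have finX: "finite X" using XV finV finite_subset by blast
  have XW: "x \<in> hubs \<and> p x \<in> hubs" if "x \<in> X" for x using p[OF that] heavy_sym by (auto simp: hubs_def)
  \<comment> \<open>The conflict relation: the heavy pairs chosen for the two vertices share an
    end.\<close>
  define R where "R = (\<lambda>x x'. x = x' \<or> x' = p x \<or> x = p x' \<or> p x = p x')"
  have "R x x \<and> card {x' \<in> X. R x x'} \<le> 2 * k + 2" if x: "x \<in> X" for x
  proof -
    have "{x' \<in> X. R x x'} \<subseteq> {x, p x} \<union> ({b. heavy x b} \<union> {b. heavy (p x) b})"
      using p heavy_sym unfolding R_def by fastforce
    then have "card {x' \<in> X. R x x'} \<le> card ({x, p x} \<union> ({b. heavy x b} \<union> {b. heavy (p x) b}))"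
      using finite_heavy by (intro card_mono) auto
    also have "\<dots> \<le> card {x, p x} + (card {b. heavy x b} + card {b. heavy (p x) b})"
      by (meson add_le_mono card_Un_le le_refl le_trans)
    also have "\<dots> \<le> 2 + (k + k)"
      using heavy_degree[of x] heavy_degree[of "p x"] by (intro add_mono) (auto simp: card_insert_if)
    finally show ?thesis by (simp add: R_def)
  qed
  moreover have "symp R" by (auto simp: R_def intro!: sympI)
  moreover have "k * (2 * k + 2) \<le> card X" using X(2) by (simp add: matching_size_def)
  ultimately obtain Z where Z: "Z \<subseteq> X" "card Z = k"
    "\<And>x x'. x \<in> Z \<Longrightarrow> x' \<in> Z \<Longrightarrow> x \<noteq> x' \<Longrightarrow> \<not> R x x'"
    using independent_selection[OF finX, of R "2 * k + 2" k] by auto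
  have finZ: "finite Z" using Z(1) finX finite_subset by blast
  let ?Y = "y ` {x \<in> Z. \<not> (\<exists>u\<in>U. E u x)}"
  have pneq: "p x \<noteq> x" if "x \<in> X" for x using p[OF that] by (auto simp: heavy_def)
  have Y: "u \<notin> hubs \<and> u \<in> V \<and> (\<exists>v\<in>U. E v u)" if "u \<in> ?Y" for u
  proof -
    obtain x where x: "x \<in> Z" "\<not> (\<exists>u\<in>U. E u x)" "u = y x" using \<open>u \<in> ?Y\<close> by blast
    then show ?thesis using adj[of x] Z(1) EV by blast
  qed
  have "has_fan k V E"
  proof (rule fan_builder[OF symE finV Z(2) k_pos U, where p = p and Y = ?Y and A = A])
    show "Z \<subseteq> V" "Z \<inter> U = {}" using Z XV X by auto
    show "inj_on p Z" using Z(3) by (auto simp: inj_on_def R_def)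
    show "p ` Z \<subseteq> V" "p ` Z \<inter> U = {}" using Z(1) p heavy_V by blast+
    show "p ` Z \<inter> Z = {}"
    proof -
      have False if "x \<in> Z" "p x \<in> Z" for x
        using Z(3)[of x "p x"] that pneq[of x] Z(1) by (auto simp: R_def)
      then show ?thesis by auto
    qed
    show "?Y \<subseteq> V" using Y by blast
    have "card ?Y \<le> card {x \<in> Z. \<not> (\<exists>u\<in>U. E u x)}" by (rule card_image_le) (use finZ in auto)
    also have "\<dots> \<le> card Z" by (rule card_mono) (use finZ in auto)
    finally show "card ?Y \<le> k" using Z(2) by simp
    have "?Y \<inter> hubs = {}" using Y by (meson disjoint_iff)
    moreover have "Z \<subseteq> hubs" "p ` Z \<subseteq> hubs" using XW Z(1) by auto
    ultimately show "?Y \<inter> Z = {}" "?Y \<inter> p ` Z = {}" by (meson disjoint_iff subsetD)+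
    show "\<exists>u\<in>U. E u z" if "z \<in> ?Y" for z using Y that by blast
    show "\<exists>u\<in>U \<union> ?Y. E u x" if "x \<in> Z" for x using adj[of x] that Z(1) by blast
    show "A x \<subseteq> V \<and> A x \<inter> U = {} \<and> 3 * k + k * (k + 1) \<le> card (A x)" if "x \<in> Z" for x
      using A[of x] that Z(1) com_V unfolding leaf_supply_def by blast
    show "E x a \<and> E (p x) a" if "x \<in> Z" "a \<in> A x" for x a
      using A[of x] that Z(1) unfolding com_def by blast
  qed
  then show False using no_fan by blast
qed

lemma com_minus_singleton:
  assumes "heavy x y"
  shows "leaf_supply k \<le> card (com x y - {u})"
proof -
  have "card (com x y) - card {u} \<le> card (com x y - {u})" by (rule diff_card_le_card_Diff) simp
  then show ?thesis using assms by (auto simp: heavy_def heavy_bound_def)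
qed

text \<open>The fewer than \<open>k\<close> heavy partners of \<open>u\<close> are set aside, so
  that the partner chosen for any other hub is not \<open>u\<close>. The remaining hub neighbours
  attach to the apex \<open>{u}\<close> directly, without a link vertex.\<close>

lemma hubs_degree:
  assumes u: "u \<in> V"
  shows "card {w \<in> hubs. E u w} < hub_degree k"
proof (rule ccontr)
  assume "\<not> ?thesis"
  then have big: "hub_degree k \<le> card {w \<in> hubs. E u w}" by simp
  define X where "X = {w \<in> hubs. E u w \<and> \<not> heavy u w}"
  define p where "p = (\<lambda>w. SOME b. heavy w b)"
  have p: "heavy w (p w)" if "w \<in> hubs" for w using that unfolding p_def hubs_def by (auto intro: someI)
  have "{w \<in> hubs. E u w} \<subseteq> X \<union> {b. heavy u b}" by (auto simp: X_def)
  then have "card {w \<in> hubs. E u w} \<le> card (X \<union> {b. heavy u b})"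
    using finite_hubs finite_heavy by (intro card_mono) (auto simp: X_def)
  also have "\<dots> \<le> card X + card {b. heavy u b}" by (rule card_Un_le)
  finally have "matching_size k \<le> card X" using big heavy_degree[of u] by (simp add: hub_degree_def)
  then show False
  proof (rule matching_fan[of "{u}" X p "\<lambda>x. x" "\<lambda>x. com x (p x) - {u}", rotated 3])
    fix x assume x: "x \<in> X"
    then have "heavy x (p x)" "\<not> heavy u x" "E u x" using p by (auto simp: X_def)
    then show "heavy x (p x) \<and> p x \<notin> {u}" using heavy_sym by blast
    show "(\<exists>u\<in>{u}. E u x) \<or> x \<notin> hubs \<and> E x x \<and> (\<exists>v\<in>{u}. E v x)"
      using \<open>E u x\<close> by blast
    show "com x (p x) - {u} \<subseteq> com x (p x) \<and> (com x (p x) - {u}) \<inter> {u} = {} \<and> leaf_supply k \<le> card (com x (p x) - {u})"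
      using com_minus_singleton[OF \<open>heavy x (p x)\<close>] by blast
  qed (use u irrE in \<open>auto simp: X_def\<close>)
qed

section \<open>Disjoint reserves of common neighbours\<close>

definition heavy_edges :: "'a set set" where
  "heavy_edges = {{a, b} | a b. heavy a b}"

lemma finite_heavy_edges: "finite heavy_edges"
  by (rule finite_subset[of _ "Pow V"]) (use heavy_V finV in \<open>auto simp: heavy_edges_def\<close>)

text \<open>
  The sets \<open>D e\<close> serve two purposes: one element of each connects the two ends of \<open>e\<close> when the
  components of the heavy pairs are contracted, and the others are leaves that no such contraction
  of a different component uses up.
\<close>

definition reserve_on :: "'a set set \<Rightarrow> ('a set \<Rightarrow> 'a set) \<Rightarrow> bool" where
  "reserve_on F D \<longleftrightarrow> disjoint_family_on D F \<and>
     (\<forall>e\<in>F. card (D e) = reserve_size k \<and> D e \<subseteq> V - hubs \<and> (\<forall>a\<in>e. \<forall>x\<in>D e. E a x))"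

lemma reserve_star:
  assumes "reserve_on F D"
  shows "finite (\<Union>b\<in>{b. heavy x b \<and> {x, b} \<in> F}. D {x, b})"
    and "card (\<Union>b\<in>{b. heavy x b \<and> {x, b} \<in> F}. D {x, b}) \<le> k * reserve_size k"
proof -
  let ?B = "{b. heavy x b \<and> {x, b} \<in> F}"
  have fB: "finite ?B" using finite_heavy by (rule rev_finite_subset) auto
  have "finite (D {x, b})" if "b \<in> ?B" for b
    using assms that finV unfolding reserve_on_def by (auto intro: finite_subset)
  then show "finite (\<Union>b\<in>?B. D {x, b})" using fB by blast
  have "card (\<Union>b\<in>?B. D {x, b}) \<le> (\<Sum>b\<in>?B. card (D {x, b}))" by (rule card_UN_le[OF fB])
  also have "\<dots> = (\<Sum>b\<in>?B. reserve_size k)" using assms by (intro sum.cong) (auto simp: reserve_on_def)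
  also have "\<dots> = card ?B * reserve_size k" by simp
  also have "\<dots> \<le> k * reserve_size k"
  proof (rule mult_right_mono)
    have "card ?B \<le> card {b. heavy x b}" by (rule card_mono[OF finite_heavy]) auto
    then show "card ?B \<le> k" using heavy_degree[of x] by simp
  qed simp
  finally show "card (\<Union>b\<in>?B. D {x, b}) \<le> k * reserve_size k" .
qed

text \<open>Heavy pairs containing \<open>a\<close> are fewer than \<open>k\<close>. For any other
  pair, a conflicting vertex \<open>y\<close> links \<open>a\<close> to an end \<open>q y\<close> of
  the pair, so \<open>matching_size k\<close> distinct ends would give a fan by
  \<open>matching_fan\<close>; fewer ends carry few reserved vertices.\<close>

lemma reserve_conflicts:
  assumes F: "F \<subseteq> heavy_edges" and D: "reserve_on F D" and a: "a \<in> V"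
  shows "card {y \<in> \<Union>(D ` F). E a y} \<le> conflict_bound k"
proof -
  let ?Y = "{y \<in> \<Union>(D ` F). E a y}"
  have fY: "finite ?Y" using finV EV by (auto intro: finite_subset[of _ V])
  have "\<exists>e. e \<in> F \<and> y \<in> D e" if "y \<in> ?Y" for y using that by blast
  then obtain e where e: "\<And>y. y \<in> ?Y \<Longrightarrow> e y \<in> F \<and> y \<in> D (e y)" by metis
  have "\<exists>q p. heavy q p \<and> e y = {q, p}" if "y \<in> ?Y" for y using e[OF that] F unfolding heavy_edges_def by blast
  then obtain q p where qp: "\<And>y. y \<in> ?Y \<Longrightarrow> heavy (q y) (p y) \<and> e y = {q y, p y}" by metis
  let ?st = "\<lambda>x. \<Union>b\<in>{b. heavy x b \<and> {x, b} \<in> F}. D {x, b}"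
  have st: "y \<in> ?st x" if "y \<in> ?Y" "x \<in> e y" for x y
  proof -
    have "\<exists>b. heavy x b \<and> e y = {x, b}" using that qp[OF that(1)] heavy_sym by (auto simp: insert_commute)
    then show ?thesis using e[OF that(1)] by auto
  qed
  let ?Y1 = "{y \<in> ?Y. a \<in> e y}" and ?Y2 = "{y \<in> ?Y. a \<notin> e y}"
  have c1: "card ?Y1 \<le> k * reserve_size k"
    using card_mono[OF reserve_star(1)[OF D, of a], of ?Y1] st reserve_star(2)[OF D, of a] by fastforce
  let ?X = "q ` ?Y2"
  have fX: "finite ?X" by (rule finite_imageI, rule finite_subset[OF _ fY]) auto
  have cX: "card ?X < matching_size k"
  proof (rule ccontr)
    assume "\<not> card ?X < matching_size k"
    then have big: "matching_size k \<le> card ?X" by simp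
    define yy where "yy = inv_into ?Y2 q"
    have yy: "yy x \<in> ?Y2 \<and> q (yy x) = x" if "x \<in> ?X" for x
      unfolding yy_def using inv_into_into[OF that] f_inv_into_f[OF that] by (rule conjI)
    show False
    proof (rule matching_fan[of "{a}" ?X "\<lambda>x. p (yy x)" yy "\<lambda>x. com x (p (yy x)) - {a}"])
      show "{a} \<subseteq> V" "conn E {a}" using a by auto
      show "matching_size k \<le> card ?X" by (rule big)
      show "?X \<inter> {a} = {}" using qp by auto
      fix x assume x: "x \<in> ?X"
      note y = yy[OF x]
      have yY: "yy x \<in> ?Y" using y by blast
      show "heavy x (p (yy x)) \<and> p (yy x) \<notin> {a}" using qp[OF yY] y by auto
      then show "com x (p (yy x)) - {a} \<subseteq> com x (p (yy x)) \<and> (com x (p (yy x)) - {a}) \<inter> {a} = {} \<and>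
          leaf_supply k \<le> card (com x (p (yy x)) - {a})"
        using com_minus_singleton by blast
      have "e (yy x) \<in> F" "yy x \<in> D (e (yy x))" "x \<in> e (yy x)" using e[OF yY] qp[OF yY] y by auto
      then have "yy x \<notin> hubs" "E x (yy x)" using D unfolding reserve_on_def by blast+
      then show "(\<exists>u\<in>{a}. E u x) \<or> yy x \<notin> hubs \<and> E (yy x) x \<and> (\<exists>u\<in>{a}. E u (yy x))"
        using E_sym yY by blast
    qed
  qed
  have "?Y2 \<subseteq> (\<Union>x\<in>?X. ?st x)"
  proof
    fix y assume y: "y \<in> ?Y2"
    then have "y \<in> ?st (q y)" using st[of y "q y"] qp[of y] by blast
    then show "y \<in> (\<Union>x\<in>?X. ?st x)" using y by blast
  qed
  then have "card ?Y2 \<le> card (\<Union>x\<in>?X. ?st x)"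
    using fX reserve_star(1)[OF D] by (intro card_mono) blast+
  also have "\<dots> \<le> (\<Sum>x\<in>?X. card (?st x))" by (rule card_UN_le[OF fX])
  also have "\<dots> \<le> (\<Sum>x\<in>?X. k * reserve_size k)" by (intro sum_mono reserve_star(2)[OF D])
  also have "\<dots> = card ?X * (k * reserve_size k)" by simp
  also have "\<dots> \<le> matching_size k * (k * reserve_size k)" using cX by (intro mult_right_mono) auto
  finally have c2: "card ?Y2 \<le> matching_size k * (k * reserve_size k)" .
  have "?Y = ?Y1 \<union> ?Y2" by blast
  then have "card ?Y \<le> card ?Y1 + card ?Y2" using card_Un_le[of ?Y1 ?Y2] by argo
  then show ?thesis using c1 c2 unfolding conflict_bound_def by linarith
qed

text \<open>Greedy, one heavy pair at a time. Only forbidden vertices adjacent to the end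
  \<open>a\<close> compete for the common neighbours of the pair, so the cost does not depend on how
  many pairs were served before.\<close>

lemma ex_reserve: "\<exists>D. reserve_on heavy_edges D"
proof -
  have "\<exists>D. reserve_on F D" if "F \<subseteq> heavy_edges" for F
    using finite_subset[OF that finite_heavy_edges] that
  proof (induction F rule: finite_induct)
    case empty
    then show ?case by (auto simp: reserve_on_def disjoint_family_on_def)
  next
    case (insert e F)
    then obtain D where D: "reserve_on F D" by blast
    obtain a b where ab: "e = {a, b}" "heavy a b" using insert.prems by (auto simp: heavy_edges_def)
    let ?Q = "{w \<in> hubs. E a w} \<union> {y \<in> \<Union>(D ` F). E a y}"
    have fQ: "finite ?Q" using finV EV by (auto intro: finite_subset[of _ V])
    have "card ?Q \<le> card {w \<in> hubs. E a w} + card {y \<in> \<Union>(D ` F). E a y}" by (rule card_Un_le)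
    also have "\<dots> \<le> hub_degree k + conflict_bound k"
      using hubs_degree[of a] reserve_conflicts[OF _ D, of a] insert.prems heavy_V[OF ab(2)]
      by (intro add_mono) auto
    finally have "card ?Q \<le> hub_degree k + conflict_bound k" .
    moreover have "card (com a b) - card ?Q \<le> card (com a b - ?Q)"
      by (rule diff_card_le_card_Diff[OF fQ])
    moreover have "heavy_bound k \<le> card (com a b)" using ab by (auto simp: heavy_def)
    ultimately have "reserve_size k \<le> card (com a b - ?Q)" unfolding heavy_bound_def by linarith
    then obtain C where C: "C \<subseteq> com a b - ?Q" "card C = reserve_size k" by (meson obtain_subset_with_card_n)
    have CD: "C \<inter> D e' = {}" if "e' \<in> F" for e' using C that by (auto simp: com_def)
    have CW: "C \<subseteq> V - hubs" using C EV by (auto simp: com_def)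
    have "reserve_on (insert e F) (D(e := C))"
      unfolding reserve_on_def
    proof (intro conjI ballI)
      show "disjoint_family_on (D(e := C)) (insert e F)"
        using D CD insert.hyps(2) unfolding reserve_on_def disjoint_family_on_def
        by (auto simp: Int_commute)
      fix e' assume e': "e' \<in> insert e F"
      show "card ((D(e := C)) e') = reserve_size k" "(D(e := C)) e' \<subseteq> V - hubs"
        using e' D C(2) CW unfolding reserve_on_def by auto
      fix u x assume "u \<in> e'" "x \<in> (D(e := C)) e'"
      then show "E u x"
        using e' D C(1) ab insert.hyps(2) unfolding reserve_on_def com_def
        by (auto split: if_splits)
    qed
    then show ?case by blast
  qed
  then show ?thesis by blast
qed

end


section \<open>The quotient by heavy pairs\<close>

definition codegree_bound :: "nat \<Rightarrow> nat" where "codegree_bound k = matching_size k + matching_size k * matching_size k * heavy_bound k"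

locale fan_reserved = fan_free +
  fixes D :: "'a set \<Rightarrow> 'a set"
  assumes reserve: "reserve_on heavy_edges D"
begin

lemma D_props:
  assumes "heavy a b"
  shows "card (D {a, b}) = reserve_size k" "D {a, b} \<subseteq> V" "D {a, b} \<inter> hubs = {}"
    "x \<in> D {a, b} \<Longrightarrow> E a x \<and> E b x"
  using reserve assms unfolding reserve_on_def heavy_edges_def by blast+

lemma D_disjoint:
  assumes "e \<in> heavy_edges" "e' \<in> heavy_edges" "e \<noteq> e'"
  shows "D e \<inter> D e' = {}"
  using reserve assms unfolding reserve_on_def disjoint_family_on_def by blast

text \<open>The choice depends only on the set of reachable vertices, hence is constant on each
  component. Naming a class by one of its vertices keeps the quotient on the original type, where a
  vertex outside \<open>hubs\<close> names its own singleton class.\<close>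

definition rep :: "'a \<Rightarrow> 'a" where
  "rep v = (SOME u. heavy\<^sup>*\<^sup>* v u)"

lemma rtranclp_heavy_sym: "heavy\<^sup>*\<^sup>* a b \<Longrightarrow> heavy\<^sup>*\<^sup>* b a"
  by (rule sympD[OF symp_rtranclp]) (auto intro: sympI heavy_sym)

lemma rep_reach: "heavy\<^sup>*\<^sup>* v (rep v)"
  unfolding rep_def by (rule someI[of _ v]) simp

lemma rep_eq_iff: "rep v = rep w \<longleftrightarrow> heavy\<^sup>*\<^sup>* v w"
proof
  assume "rep v = rep w"
  then show "heavy\<^sup>*\<^sup>* v w"
    using rep_reach[of v] rep_reach[of w] rtranclp_heavy_sym rtranclp_trans[of heavy v "rep v" w] by metis
next
  assume "heavy\<^sup>*\<^sup>* v w"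
  then have "heavy\<^sup>*\<^sup>* v u \<longleftrightarrow> heavy\<^sup>*\<^sup>* w u" for u
    by (meson rtranclp_heavy_sym rtranclp_trans)
  then show "rep v = rep w" by (simp add: rep_def)
qed

lemma rep_rep [simp]: "rep (rep v) = rep v"
  using rep_eq_iff rep_reach rtranclp_heavy_sym by blast

lemma heavy_rep: "heavy a b \<Longrightarrow> rep a = rep b"
  by (simp add: rep_eq_iff r_into_rtranclp)

lemma reach_cases: "heavy\<^sup>*\<^sup>* a b \<Longrightarrow> a = b \<or> a \<in> hubs \<and> b \<in> hubs"
  by (induction rule: rtranclp_induct) (use heavy_sym in \<open>auto simp: hubs_def\<close>)

lemma rep_nonhub [simp]: "v \<notin> hubs \<Longrightarrow> rep v = v"
  using reach_cases[OF rep_reach[of v]] by simp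

lemma rep_hub_iff [simp]: "rep v \<in> hubs \<longleftrightarrow> v \<in> hubs"
  using reach_cases[OF rep_reach[of v]] by auto

lemma rep_V: "v \<in> V \<Longrightarrow> rep v \<in> V"
  using reach_cases[OF rep_reach[of v]] hubs_V by auto

definition cl :: "'a \<Rightarrow> 'a set" where
  "cl x = {v \<in> V. rep v = x}"

definition classes :: "'a set" where
  "classes = rep ` V"

text \<open>Adjacency is read off the classes \<open>cl\<close>, not the bags below, so it does not
  depend on a choice of connectors, and a connector remains a vertex of the quotient with all its
  edges.\<close>

definition qadj :: "'a \<Rightarrow> 'a \<Rightarrow> bool" where
  "qadj x y \<longleftrightarrow> x \<in> classes \<and> y \<in> classes \<and> x \<noteq> y \<and> touch E (cl x) (cl y)"

lemma finite_classes: "finite classes"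
  using finV by (simp add: classes_def)

lemma classes_V: "classes \<subseteq> V"
  using rep_V by (auto simp: classes_def)

lemma qadj_sym: "qadj x y \<Longrightarrow> qadj y x"
  using touch_sym[OF symE] by (auto simp: qadj_def)

lemma rep_class: "x \<in> classes \<Longrightarrow> rep x = x"
  by (auto simp: classes_def)

lemma in_cl_self: "x \<in> classes \<Longrightarrow> x \<in> cl x"
  using classes_V rep_class by (auto simp: cl_def)

lemma cl_V: "cl x \<subseteq> V"
  by (auto simp: cl_def)

lemma cl_disjoint: "x \<noteq> y \<Longrightarrow> cl x \<inter> cl y = {}"
  by (auto simp: cl_def)

lemma cl_hub: "x \<in> hubs \<Longrightarrow> cl x \<subseteq> hubs"
  by (auto simp: cl_def)

lemma cl_nonhub: "x \<in> classes \<Longrightarrow> x \<notin> hubs \<Longrightarrow> cl x = {x}"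
  using in_cl_self by (auto simp: cl_def)

section \<open>Making the classes connected\<close>

definition connector :: "('a set \<Rightarrow> 'a) \<Rightarrow> bool" where
  "connector c \<longleftrightarrow> (\<forall>e\<in>heavy_edges. c e \<in> D e)"

definition bag :: "('a set \<Rightarrow> 'a) \<Rightarrow> 'a \<Rightarrow> 'a set" where
  "bag c x = cl x \<union> c ` {e \<in> heavy_edges. e \<subseteq> cl x}"

lemma connectorD:
  assumes "connector c" "heavy a b"
  shows "c {a, b} \<in> V" "c {a, b} \<notin> hubs" "E a (c {a, b})" "E (c {a, b}) b"
  using D_props[OF assms(2)] assms E_sym unfolding connector_def heavy_edges_def by blast+

lemma bag_V:
  assumes "connector c"
  shows "bag c x \<subseteq> V"
proof -
  have "c e \<in> V" if "e \<in> heavy_edges" for e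
    using that connectorD[OF assms] by (auto simp: heavy_edges_def)
  then show ?thesis using cl_V by (auto simp: bag_def)
qed

text \<open>Each step of a path of heavy pairs is replaced by two edges through the connector of
  that pair, which lies in the bag because the path stays in the class.\<close>

lemma conn_bag:
  assumes c: "connector c" and x: "x \<in> classes"
  shows "conn E (bag c x)"
proof (rule conn_rootI[OF symE])
  let ?R = "(restr E (bag c x))\<^sup>*\<^sup>*"
  show "x \<in> bag c x" using in_cl_self[OF x] by (auto simp: bag_def)
  have R: "?R x u" if "u \<in> cl x" for u
  proof -
    have "heavy\<^sup>*\<^sup>* x u" using that rep_class[OF x] rep_eq_iff by (auto simp: cl_def)
    then have "u \<in> cl x \<and> ?R x u"
    proof (induction rule: rtranclp_induct)
      case base
      then show ?case using in_cl_self[OF x] by simp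
    next
      case (step y z)
      then have z: "z \<in> cl x" using heavy_rep[OF step.hyps(2)] heavy_V[OF step.hyps(2)] by (auto simp: cl_def)
      then have "c {y, z} \<in> bag c x"
        using step by (auto simp: bag_def heavy_edges_def)
      moreover have "E y (c {y, z})" "E (c {y, z}) z"
        using connectorD[OF c step.hyps(2)] by auto
      ultimately have "restr E (bag c x) y (c {y, z})" "restr E (bag c x) (c {y, z}) z"
        using step z by (auto simp: bag_def)
      then have "?R x z"
        using rtranclp.rtrancl_into_rtrancl[OF rtranclp.rtrancl_into_rtrancl, of "restr E (bag c x)"]
          step.IH by blast
      then show ?case using z by blast
    qed
    then show ?thesis by blast
  qed
  fix y assume y: "y \<in> bag c x"
  then consider "y \<in> cl x" | a b where "heavy a b" "a \<in> cl x" "y = c {a, b}"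
    by (auto simp: bag_def heavy_edges_def)
  then show "?R x y"
  proof cases
    case 1
    then show ?thesis by (rule R)
  next
    case 2
    then have "restr E (bag c x) a y" using y connectorD[OF c 2(1)] by (auto simp: bag_def)
    with R[OF 2(2)] show ?thesis by (rule rtranclp.rtrancl_into_rtrancl)
  qed
qed

text \<open>A reserve contains no hubs and is disjoint from the reserves that supply the connectors
  of the bag. Only a singleton class can meet it, if its vertex was itself reserved; this is the
  extra vertex in \<open>reserve_size\<close>.\<close>

lemma D_inter_bag:
  assumes "connector c" "x \<in> classes" "heavy a b" "a \<notin> cl x"
  shows "D {a, b} \<inter> bag c x \<subseteq> {x}"
proof
  fix y assume y: "y \<in> D {a, b} \<inter> bag c x"
  then have yW: "y \<notin> hubs" using D_props[OF assms(3)] by blast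
  have "y \<notin> c ` {e \<in> heavy_edges. e \<subseteq> cl x}"
  proof
    assume "y \<in> c ` {e \<in> heavy_edges. e \<subseteq> cl x}"
    then obtain e where e: "e \<in> heavy_edges" "e \<subseteq> cl x" "y = c e" by blast
    then have "y \<in> D e" "e \<noteq> {a, b}" using assms unfolding connector_def by auto
    then show False using D_disjoint[OF e(1), of "{a, b}"] y assms(3) unfolding heavy_edges_def by blast
  qed
  then have "y \<in> cl x" using y by (auto simp: bag_def)
  then show "y \<in> {x}" using yW by (auto simp: cl_def)
qed

lemma ex_connector: "\<exists>c. connector c"
proof -
  have "\<exists>y. y \<in> D e" if "e \<in> heavy_edges" for e
  proof -
    have "card (D e) = reserve_size k" using reserve that by (simp add: reserve_on_def)
    then show ?thesis by (cases "D e = {}") (auto simp: reserve_size_def)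
  qed
  then show ?thesis unfolding connector_def by metis
qed

text \<open>A contracted class plays the part of a single vertex in the apex. Its bag may be large
  enough to contain all common neighbours of a heavy pair, so the leaves come from the reserves,
  which lose at most one vertex to the bag.\<close>

lemma class_fan:
  assumes x: "x \<in> classes" and Q: "Q \<subseteq> hubs" "Q \<inter> cl x = {}" "matching_size k \<le> card Q"
    and adj: "\<And>w. w \<in> Q \<Longrightarrow> (\<exists>u\<in>cl x. E u w) \<or> (y w \<notin> hubs \<and> E (y w) w \<and> (\<exists>u\<in>cl x. E u (y w)))"
  shows False
proof -
  obtain c where c: "connector c" using ex_connector by blast
  define p where "p = (\<lambda>w. SOME b. heavy w b)"
  have p: "heavy w (p w)" if "w \<in> Q" for w
    using that Q(1) unfolding p_def hubs_def by (auto intro: someI)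
  have bagW: "bag c x \<inter> hubs \<subseteq> cl x"
    using connectorD[OF c] by (auto simp: bag_def heavy_edges_def)
  have pcl: "p w \<notin> cl x" if "w \<in> Q" for w
    using heavy_rep[OF p[OF that]] heavy_V[OF p[OF that]] Q(2) that by (auto simp: cl_def)
  show False
  proof (rule matching_fan[of "bag c x" Q p y "\<lambda>w. D {w, p w} - bag c x"])
    show "bag c x \<subseteq> V" by (rule bag_V[OF c])
    show "conn E (bag c x)" by (rule conn_bag[OF c x])
    show "Q \<inter> bag c x = {}" using bagW Q by blast
    show "matching_size k \<le> card Q" by fact
    fix w assume w: "w \<in> Q"
    have "p w \<in> hubs" using heavy_sym[OF p[OF w]] by (auto simp: hubs_def)
    then show "heavy w (p w) \<and> p w \<notin> bag c x" using bagW pcl[OF w] p[OF w] by blast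
    have "cl x \<subseteq> bag c x" by (auto simp: bag_def)
    then show "(\<exists>u\<in>bag c x. E u w) \<or> y w \<notin> hubs \<and> E (y w) w \<and> (\<exists>u\<in>bag c x. E u (y w))"
      using adj[OF w] by blast
    have "w \<notin> cl x" using Q w by blast
    then have sub: "D {w, p w} - {x} \<subseteq> D {w, p w} - bag c x"
      using D_inter_bag[OF c x p[OF w]] by blast
    have fD: "finite (D {w, p w})" using D_props(2)[OF p[OF w]] finV finite_subset by blast
    have "card (D {w, p w}) - card {x} \<le> card (D {w, p w} - {x})" by (rule diff_card_le_card_Diff) simp
    also have "\<dots> \<le> card (D {w, p w} - bag c x)" by (rule card_mono[OF _ sub]) (use fD in simp)
    finally have "leaf_supply k \<le> card (D {w, p w} - bag c x)" using D_props(1)[OF p[OF w]] by (simp add: reserve_size_def)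
    then show "D {w, p w} - bag c x \<subseteq> com w (p w) \<and> (D {w, p w} - bag c x) \<inter> bag c x = {} \<and>
        leaf_supply k \<le> card (D {w, p w} - bag c x)"
      using D_props(4)[OF p[OF w]] by (auto simp: com_def)
  qed
qed

section \<open>Degrees and codegrees in the quotient\<close>

lemma nontrivial_degree:
  assumes x: "x \<in> classes"
  shows "card {z \<in> hubs. qadj x z} < matching_size k"
proof (rule ccontr)
  assume "\<not> ?thesis"
  then have big: "matching_size k \<le> card {z \<in> hubs. qadj x z}" by simp
  have "\<exists>w. w \<in> cl z \<and> (\<exists>u\<in>cl x. E u w)" if "z \<in> {z \<in> hubs. qadj x z}" for z
    using that by (auto simp: qadj_def touch_def)
  then obtain w where w: "\<And>z. z \<in> {z \<in> hubs. qadj x z} \<Longrightarrow> w z \<in> cl z \<and> (\<exists>u\<in>cl x. E u (w z))"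
    by metis
  let ?Z = "{z \<in> hubs. qadj x z}"
  show False
  proof (rule class_fan[OF x, of "w ` ?Z"])
    show "w ` ?Z \<subseteq> hubs" using w cl_hub by blast
    show "w ` ?Z \<inter> cl x = {}" using w cl_disjoint by (fastforce simp: qadj_def)
    have "inj_on w ?Z"
      by (rule inj_onI) (use w in \<open>auto simp: cl_def, metis\<close>)
    then show "matching_size k \<le> card (w ` ?Z)" using big by (simp add: card_image)
    fix v assume "v \<in> w ` ?Z"
    then show "(\<exists>u\<in>cl x. E u v) \<or> v \<notin> hubs \<and> E v v \<and> (\<exists>u\<in>cl x. E u v)" using w by blast
  qed
qed

lemma matching_size_gt_1: "1 < matching_size k"
proof -
  have "1 * 4 \<le> k * (2 * k + 2)" using k_pos by (intro mult_mono) auto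
  then show ?thesis by (simp add: matching_size_def)
qed

text \<open>If \<open>x\<close> is a hub, so are the attachments \<open>q y\<close>, and each is
  linked to the class of \<open>z\<close> by a vertex \<open>y\<close> outside \<open>hubs\<close>;
  many of them contradict \<open>class_fan\<close> at \<open>z\<close>. Otherwise the class of
  \<open>x\<close> is a singleton.\<close>

lemma attachment_bound:
  assumes xz: "x \<in> classes" "z \<in> classes" "x \<noteq> z"
    and Y: "finite Y" "Y \<inter> hubs = {}"
    and q: "\<And>y. y \<in> Y \<Longrightarrow> q y \<in> cl x \<and> E (q y) y"
    and r: "\<And>y. y \<in> Y \<Longrightarrow> \<exists>u\<in>cl z. E u y"
  shows "card (q ` Y) < matching_size k"
proof (rule ccontr)
  assume "\<not> ?thesis"
  then have big: "matching_size k \<le> card (q ` Y)" by simp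
  show False
  proof (cases "x \<in> hubs")
    case True
    define yy where "yy = inv_into Y q"
    have yy: "yy w \<in> Y \<and> q (yy w) = w" if "w \<in> q ` Y" for w
      unfolding yy_def using inv_into_into[OF that] f_inv_into_f[OF that] by (rule conjI)
    show ?thesis
    proof (rule class_fan[OF xz(2), of "q ` Y" yy])
      show "q ` Y \<subseteq> hubs" using q cl_hub[OF True] by blast
      show "q ` Y \<inter> cl z = {}" using q cl_disjoint[OF xz(3)] by blast
      show "matching_size k \<le> card (q ` Y)" by (rule big)
      fix w assume w: "w \<in> q ` Y"
      have "E (yy w) w" using q[of "yy w"] yy[OF w] E_sym by auto
      then show "(\<exists>u\<in>cl z. E u w) \<or> yy w \<notin> hubs \<and> E (yy w) w \<and> (\<exists>u\<in>cl z. E u (yy w))"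
        using yy[OF w] r Y(2) by blast
    qed
  next
    case False
    then have "q ` Y \<subseteq> {x}" using cl_nonhub[OF xz(1)] q by blast
    then have "card (q ` Y) \<le> 1" using card_mono[of "{x}" "q ` Y"] by simp
    then show ?thesis using big matching_size_gt_1 by simp
  qed
qed

text \<open>A common neighbour outside \<open>hubs\<close> is, in the graph itself, a common
  neighbour of two attachment vertices, one in each class. Such pairs are few by
  \<open>attachment_bound\<close>, and none is heavy because heavy pairs never cross classes. The
  hubs are covered by \<open>nontrivial_degree\<close>.\<close>

lemma codegree:
  assumes xz: "x \<in> classes" "z \<in> classes" "x \<noteq> z"
  shows "card {y. qadj x y \<and> qadj z y} \<le> codegree_bound k"
proof -
  let ?P = "{y. qadj x y \<and> qadj z y}"
  let ?Y = "{y \<in> ?P. y \<notin> hubs}"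
  have fP: "finite ?P" using finite_classes by (auto simp: qadj_def intro: finite_subset)
  then have fY: "finite ?Y" by (rule rev_finite_subset) auto
  have "\<exists>u\<in>cl v. E u y" if "y \<notin> hubs" "qadj v y" for v y
    using that cl_nonhub[of y] by (auto simp: qadj_def touch_def)
  then have "\<forall>y\<in>?Y. \<exists>q r. q \<in> cl x \<and> E q y \<and> r \<in> cl z \<and> E r y" by blast
  then obtain q r where qr: "\<And>y. y \<in> ?Y \<Longrightarrow> q y \<in> cl x \<and> E (q y) y \<and> r y \<in> cl z \<and> E (r y) y"
    by metis
  have cq: "card (q ` ?Y) < matching_size k"
    by (rule attachment_bound[OF xz fY]) (use qr in auto)
  have cr: "card (r ` ?Y) < matching_size k"
    by (rule attachment_bound[OF xz(2,1) xz(3)[symmetric] fY]) (use qr in auto)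
  let ?QR = "q ` ?Y \<times> r ` ?Y"
  have fQR: "finite ?QR" using fY by simp
  have ccom: "card (com a b) \<le> heavy_bound k" if "(a, b) \<in> ?QR" for a b
  proof -
    have "a \<in> cl x" "b \<in> cl z" using that qr by auto
    then have "rep a \<noteq> rep b" using xz(3) by (auto simp: cl_def)
    then have "\<not> heavy a b" "a \<noteq> b" using heavy_rep by auto
    then show ?thesis by (auto simp: heavy_def)
  qed
  have "?Y \<subseteq> (\<Union>p\<in>?QR. com (fst p) (snd p))"
  proof
    fix y assume y: "y \<in> ?Y"
    then have "y \<in> com (q y) (r y)" using qr by (auto simp: com_def)
    then show "y \<in> (\<Union>p\<in>?QR. com (fst p) (snd p))" using y by (intro UN_I[of "(q y, r y)"]) auto
  qed
  then have "card ?Y \<le> card (\<Union>p\<in>?QR. com (fst p) (snd p))"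
    using fQR finite_com by (intro card_mono) blast+
  also have "\<dots> \<le> (\<Sum>p\<in>?QR. card (com (fst p) (snd p)))" by (rule card_UN_le[OF fQR])
  also have "\<dots> \<le> (\<Sum>p\<in>?QR. heavy_bound k)" by (intro sum_mono) (use ccom in auto)
  also have "\<dots> = card (q ` ?Y) * card (r ` ?Y) * heavy_bound k" by (simp add: card_cartesian_product)
  also have "\<dots> \<le> matching_size k * matching_size k * heavy_bound k" using cq cr by (intro mult_mono) auto
  finally have cY: "card ?Y \<le> matching_size k * matching_size k * heavy_bound k" .
  have cW: "card {y \<in> ?P. y \<in> hubs} \<le> matching_size k"
  proof -
    have "card {y \<in> ?P. y \<in> hubs} \<le> card {y \<in> hubs. qadj x y}"
      using finite_hubs by (intro card_mono) auto
    then show ?thesis using nontrivial_degree[OF xz(1)] by simp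
  qed
  have "card ?P \<le> card {y \<in> ?P. y \<in> hubs} + card ?Y"
  proof (rule order_trans[OF card_mono card_Un_le])
    show "finite ({y \<in> ?P. y \<in> hubs} \<union> ?Y)" by (rule rev_finite_subset[OF fP]) auto
  qed auto
  then show ?thesis using cY cW by (simp add: codegree_bound_def)
qed

end


section \<open>Light edges and the colouring\<close>

text \<open>
  Deleting an edge between two vertices of degree at most \<open>l\<close> never matters for the defect, and a
  vertex of degree one is recoloured against its neighbour.
\<close>

lemma light_colouring:
  fixes Q :: "'a \<Rightarrow> 'a \<Rightarrow> bool"
  assumes fin: "finite {(x, y). Q x y}" and irr: "\<And>x. \<not> Q x x"
    and light: "\<And>F x y. symp F \<Longrightarrow> (\<And>x y. F x y \<Longrightarrow> Q x y) \<Longrightarrow> F x y \<Longrightarrow>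
       \<exists>x y. F x y \<and> (card {z. F x z} \<le> l \<and> card {z. F y z} \<le> l \<or> {z. F x z} = {y})"
    and F: "symp F" "\<And>x y. F x y \<Longrightarrow> Q x y"
  shows "\<exists>c :: 'a \<Rightarrow> bool. \<forall>x. card {y. F x y \<and> c y = c x} \<le> l"
  using F
proof (induction "card {(x, y). F x y}" arbitrary: F rule: less_induct)
  case less
  note sym = sympD[OF less.prems(1)]
  have finF: "finite {(x, y). F x y}" by (rule finite_subset[OF _ fin]) (use less.prems in auto)
  have finN: "finite {z. F x z}" for x
  proof -
    have "{z. F x z} \<subseteq> snd ` {(x, y). F x y}" by force
    then show ?thesis using finF finite_subset by blast
  qed
  show ?case
  proof (cases "\<exists>x y. F x y")
    case False
    then show ?thesis by auto
  next
    case True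
    then obtain x y where xy: "F x y"
      "card {z. F x z} \<le> l \<and> card {z. F y z} \<le> l \<or> {z. F x z} = {y}"
      using light[OF less.prems] by blast
    have neq: "x \<noteq> y" using xy(1) less.prems(2) irr by blast
    define F' where "F' = (\<lambda>u v. F u v \<and> (u, v) \<noteq> (x, y) \<and> (u, v) \<noteq> (y, x))"
    have "{(u, v). F' u v} \<subset> {(u, v). F u v}" using xy(1) by (auto simp: F'_def)
    then have "card {(u, v). F' u v} < card {(u, v). F u v}" by (rule psubset_card_mono[OF finF])
    moreover have "symp F'" using sym by (auto simp: F'_def intro!: sympI)
    moreover have "\<And>u v. F' u v \<Longrightarrow> Q u v" using less.prems(2) by (auto simp: F'_def)
    ultimately obtain c :: "'a \<Rightarrow> bool" where c: "\<And>v. card {z. F' v z \<and> c z = c v} \<le> l"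
      using less.hyps[of F'] by blast
    show ?thesis
    proof (cases "{z. F x z} = {y}")
      case True
      then have xF: "F x v \<longleftrightarrow> v = y" for v by blast
      have Fx: "F v x \<longleftrightarrow> v = y" for v using xF sym by blast
      define c' where "c' = c(x := \<not> c y)"
      have "card {z. F v z \<and> c' z = c' v} \<le> l" for v
      proof (cases "v = x")
        case True
        have "{z. F x z \<and> c' z = c' x} = {}"
          using xF neq by (simp add: c'_def)
        then show ?thesis using True by (metis card.empty le0)
      next
        case False
        have "{z. F v z \<and> c' z = c' v} \<subseteq> {z. F' v z \<and> c z = c v}"
        proof
          fix z assume z: "z \<in> {z. F v z \<and> c' z = c' v}"
          have "z \<noteq> x"
          proof
            assume "z = x"
            then have "v = y" using z Fx by blast
            then show False using z \<open>z = x\<close> False by (simp add: c'_def)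
          qed
          then show "z \<in> {z. F' v z \<and> c z = c v}"
            using z False by (auto simp: c'_def F'_def)
        qed
        moreover have "finite {z. F' v z \<and> c z = c v}"
          by (rule finite_subset[OF _ finN[of v]]) (auto simp: F'_def)
        ultimately show ?thesis using card_mono c le_trans by metis
      qed
      then show ?thesis by blast
    next
      case False
      then have low: "card {z. F x z} \<le> l" "card {z. F y z} \<le> l" using xy(2) by blast+
      have "card {z. F v z \<and> c z = c v} \<le> l" for v
      proof (cases "v = x \<or> v = y")
        case True
        have "card {z. F v z \<and> c z = c v} \<le> card {z. F v z}" by (rule card_mono[OF finN]) auto
        then show ?thesis using True low by auto
      next
        case False
        then have "{z. F v z \<and> c z = c v} = {z. F' v z \<and> c z = c v}" by (auto simp: F'_def)
        then show ?thesis using c by simp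
      qed
      then show ?thesis by blast
    qed
  qed
qed

definition density_bound :: "nat \<Rightarrow> nat" where "density_bound k = 2 * (k * (k + 2))"
text \<open>The value at which the last count in \<open>light_edge\<close> closes:
  \<open>4 * density_bound k\<close> bounds the arcs per vertex over four systems of connectors, and
  the other factor bounds the number of all vertices per high vertex.\<close>

definition light_bound :: "nat \<Rightarrow> nat" where "light_bound k = 4 * density_bound k * (4 * codegree_bound k * density_bound k + 1)"

context fan_free
begin

lemma sparse_blow_up:
  assumes "finite Y" "symp G" "\<And>x. \<not> G x x" "disjoint_family_on b Y"
    "\<And>y. y \<in> Y \<Longrightarrow> b y \<subseteq> V \<and> conn E (b y)"
    "\<And>x y. x \<in> Y \<Longrightarrow> y \<in> Y \<Longrightarrow> G x y \<Longrightarrow> touch E (b x) (b y)"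
  shows "card (arcs_in Y G) \<le> density_bound k * card Y"
proof (cases "Y = {}")
  case True
  then show ?thesis by (simp add: arcs_in_def)
next
  case False
  have "\<not> has_fan k Y G"
    using has_fan_blow_up[OF symE _ assms(4)] assms no_fan by blast
  then show ?thesis
    using dense_has_fan[OF assms(1-3) False k_pos] unfolding density_bound_def by linarith
qed

end

context fan_reserved
begin

text \<open>A connector lies in the bag that it holds together and is also a class of its own, so
  those classes are left out. The remaining bags could meet only in connectors, but as reserves are
  disjoint, a connector determines its pair and hence its class.\<close>

lemma bag_disjoint:
  assumes c: "connector c"
  shows "disjoint_family_on (bag c) (classes - c ` heavy_edges)"
  unfolding disjoint_family_on_def
proof (intro ballI impI)
  fix x y assume xy: "x \<in> classes - c ` heavy_edges" "y \<in> classes - c ` heavy_edges" "x \<noteq> y"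
  have cW: "c e \<notin> hubs" if "e \<in> heavy_edges" for e
    using that connectorD[OF c] by (auto simp: heavy_edges_def)
  have cc: "v \<notin> c ` heavy_edges" if "z \<in> classes - c ` heavy_edges" "v \<in> cl z" for v z
    by (cases "z \<in> hubs") (use that cl_hub[of z] cl_nonhub[of z] cW in auto)
  have ce: "e = e'" if "e \<in> heavy_edges" "e' \<in> heavy_edges" "c e = c e'" for e e'
    using D_disjoint[of e e'] that c unfolding connector_def by (metis disjoint_iff)
  have ne: "e \<noteq> {}" if "e \<in> heavy_edges" for e using that by (auto simp: heavy_edges_def)
  show "bag c x \<inter> bag c y = {}"
  proof (rule ccontr)
    assume "bag c x \<inter> bag c y \<noteq> {}"
    then obtain v where v: "v \<in> bag c x" "v \<in> bag c y" by blast
    show False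
    proof (cases "v \<in> c ` heavy_edges")
      case False
      then have "v \<in> cl x" "v \<in> cl y" using v by (auto simp: bag_def)
      then show False using cl_disjoint[OF xy(3)] by blast
    next
      case True
      then have "v \<notin> cl x" "v \<notin> cl y" using cc xy by blast+
      then obtain e e' where "e \<in> heavy_edges" "e \<subseteq> cl x" "v = c e" "e' \<in> heavy_edges" "e' \<subseteq> cl y" "v = c e'"
        using v by (auto simp: bag_def)
      then show False using ce[of e e'] ne cl_disjoint[OF xy(3)] by blast
    qed
  qed
qed

lemma bag_touch:
  assumes "qadj x y"
  shows "touch E (bag c x) (bag c y)"
  using assms unfolding qadj_def by (auto intro: touch_mono simp: bag_def)

text \<open>
  Connectors absorbed by a contraction are lost as vertices of the quotient. With four disjoint
  systems of connectors, any three vertices survive in one of them.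
\<close>

lemma ex_connectors:
  obtains c :: "nat \<Rightarrow> 'a set \<Rightarrow> 'a" where "\<And>j. j < 4 \<Longrightarrow> connector (c j)"
    "\<And>i j. i < 4 \<Longrightarrow> j < 4 \<Longrightarrow> i \<noteq> j \<Longrightarrow> c i ` heavy_edges \<inter> c j ` heavy_edges = {}"
proof -
  have "\<exists>f. f ` {..<4::nat} \<subseteq> D e \<and> inj_on f {..<4}" if "e \<in> heavy_edges" for e
  proof -
    have cD: "card (D e) = reserve_size k" using reserve that by (simp add: reserve_on_def)
    have "4 \<le> reserve_size k" using k_pos by (cases k) (auto simp: reserve_size_def leaf_supply_def)
    then have "card {..<4::nat} \<le> card (D e)" using cD by simp
    moreover have "finite (D e)" using \<open>4 \<le> reserve_size k\<close> cD by (metis card.infinite not_numeral_le_zero)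
    ultimately show ?thesis using card_le_inj[of "{..<4::nat}" "D e"] by auto
  qed
  then obtain f where f: "\<And>e. e \<in> heavy_edges \<Longrightarrow> f e ` {..<4::nat} \<subseteq> D e \<and> inj_on (f e) {..<4}"
    by metis
  have fD: "f e j \<in> D e" if "e \<in> heavy_edges" "j < 4" for e j using f[OF that(1)] that(2) by blast
  show ?thesis
  proof (rule that[of "\<lambda>j e. f e j"])
    show "connector (\<lambda>e. f e j)" if "j < 4" for j using fD that by (simp add: connector_def)
    fix i j :: nat assume ij: "i < 4" "j < 4" "i \<noteq> j"
    have "f e i \<noteq> f e' j" if "e \<in> heavy_edges" "e' \<in> heavy_edges" for e e'
    proof (cases "e = e'")
      case True
      then show ?thesis using f[OF that(1)] ij by (auto simp: inj_on_def)
    next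
      case False
      then show ?thesis using D_disjoint[OF that False] fD that ij by (metis disjoint_iff)
    qed
    then show "(\<lambda>e. f e i) ` heavy_edges \<inter> (\<lambda>e. f e j) ` heavy_edges = {}" by blast
  qed
qed

text \<open>
  Otherwise the low vertices \<open>A\<close> are independent and have two neighbours each in the set \<open>B\<close> of high
  vertices. Contracting one low vertex for each pair of high vertices that occurs gives a minor on
  \<open>B\<close>, so that few pairs occur; by the codegree bound \<open>A\<close> is linear in \<open>B\<close>, and the sparsity of
  the quotient contradicts the high degrees in \<open>B\<close>.
\<close>

lemma light_edge:
  assumes symF: "symp F" and FQ: "\<And>x y. F x y \<Longrightarrow> qadj x y" and ne: "F x0 y0"
  shows "\<exists>x y. F x y \<and> (card {z. F x z} \<le> light_bound k \<and> card {z. F y z} \<le> light_bound k \<or> {z. F x z} = {y})"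
proof (rule ccontr)
  assume contra: "\<not> ?thesis"
  note sym = sympD[OF symF]
  have FX: "x \<in> classes" "y \<in> classes" "x \<noteq> y" if "F x y" for x y using FQ[OF that] by (auto simp: qadj_def)
  have finN: "finite {z. F x z}" for x
    by (rule finite_subset[OF _ finite_classes]) (use FX in auto)
  define B where "B = {x \<in> classes. light_bound k < card {z. F x z}}"
  define A where "A = {x \<in> classes. card {z. F x z} \<le> light_bound k \<and> {z. F x z} \<noteq> {}}"
  have fB: "finite B" and fA: "finite A" and BX: "B \<subseteq> classes" and AX: "A \<subseteq> classes" and AB: "A \<inter> B = {}"
    using finite_classes by (auto simp: A_def B_def)
  have F_low: "y \<in> B" if "F x y" "x \<in> A" for x y
    using contra that FX[OF that(1)] by (force simp: A_def B_def)
  have FAB: "x \<in> A \<union> B" if "F x y" for x y using FX[OF that] that by (auto simp: A_def B_def)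
  have Bne: "B \<noteq> {}" using F_low ne FAB by blast
  obtain c where c: "\<And>j. j < (4::nat) \<Longrightarrow> connector (c j)"
    and cd: "\<And>i j. i < 4 \<Longrightarrow> j < 4 \<Longrightarrow> i \<noteq> j \<Longrightarrow> c i ` heavy_edges \<inter> c j ` heavy_edges = {}"
    using ex_connectors by metis
  have free: "\<exists>j<4. x \<notin> c j ` heavy_edges \<and> y \<notin> c j ` heavy_edges \<and> z \<notin> c j ` heavy_edges" for x y z
  proof (rule ccontr)
    assume "\<not> ?thesis"
    then have "\<forall>j\<in>{..<4}. \<exists>w\<in>{x,y,z}. w \<in> c j ` heavy_edges" by auto
    then obtain g where g: "\<And>j. j \<in> {..<4} \<Longrightarrow> g j \<in> {x,y,z} \<and> g j \<in> c j ` heavy_edges" by metis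
    have "inj_on g {..<4}"
    proof (rule inj_onI, rule ccontr)
      fix i j assume ij: "i \<in> {..<4}" "j \<in> {..<4}" "g i = g j" "i \<noteq> j"
      then have "g i \<in> c i ` heavy_edges \<inter> c j ` heavy_edges" using g by (metis IntI)
      moreover have "c i ` heavy_edges \<inter> c j ` heavy_edges = {}" using cd[of i j] ij by simp
      ultimately show False by blast
    qed
    then have "card (g ` {..<4}) = 4" by (simp add: card_image)
    moreover have "card (g ` {..<4}) \<le> card {x,y,z}" by (rule card_mono) (use g in auto)
    moreover have "card {x, y, z} \<le> 3" by (simp add: card_insert_if)
    ultimately show False by linarith
  qed
  let ?Y = "A \<union> B"
  have arcs: "card (arcs_in ?Y F) \<le> 4 * density_bound k * card ?Y"
  proof -
    have "arcs_in ?Y F \<subseteq> (\<Union>j<4. arcs_in (?Y - c j ` heavy_edges) F)"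
    proof
      fix p assume "p \<in> arcs_in ?Y F"
      then obtain x y where xy: "p = (x, y)" "x \<in> ?Y" "y \<in> ?Y" "F x y" by (auto simp: arcs_in_def)
      obtain j where "j < 4" "x \<notin> c j ` heavy_edges" "y \<notin> c j ` heavy_edges" using free[of x y x] by blast
      then show "p \<in> (\<Union>j<4. arcs_in (?Y - c j ` heavy_edges) F)"
        using xy by (intro UN_I[of j]) (simp_all add: arcs_in_def)
    qed
    then have "card (arcs_in ?Y F) \<le> card (\<Union>j<4. arcs_in (?Y - c j ` heavy_edges) F)"
      by (rule card_mono[rotated]) (use fA fB in \<open>auto intro!: finite_arcs_in\<close>)
    also have "\<dots> \<le> (\<Sum>j<4. card (arcs_in (?Y - c j ` heavy_edges) F))" by (rule card_UN_le) simp
    also have "\<dots> \<le> (\<Sum>j<(4::nat). density_bound k * card ?Y)"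
    proof (rule sum_mono)
      fix j assume "j \<in> {..<4::nat}"
      then have cj: "connector (c j)" using c by simp
      have "card (arcs_in (?Y - c j ` heavy_edges) F) \<le> density_bound k * card (?Y - c j ` heavy_edges)"
      proof (rule sparse_blow_up[OF _ symF])
        show "disjoint_family_on (bag (c j)) (?Y - c j ` heavy_edges)"
          using bag_disjoint[OF cj] by (rule disjoint_family_on_mono[rotated]) (use AX BX in auto)
        show "bag (c j) y \<subseteq> V \<and> conn E (bag (c j) y)" if "y \<in> ?Y - c j ` heavy_edges" for y
          using bag_V[OF cj] conn_bag[OF cj] that AX BX by blast
        show "touch E (bag (c j) x) (bag (c j) y)" if "F x y" for x y
          using bag_touch FQ that by blast
        show "\<not> F x x" for x using FX(3) by blast
      qed (use fA fB in auto)
      also have "\<dots> \<le> density_bound k * card ?Y" using fA fB by (intro mult_left_mono card_mono) auto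
      finally show "card (arcs_in (?Y - c j ` heavy_edges) F) \<le> density_bound k * card ?Y" .
    qed
    finally show ?thesis by simp
  qed
  have "\<exists>u v. u \<noteq> v \<and> F a u \<and> F a v" if a: "a \<in> A" for a
  proof -
    obtain u where u: "F a u" using a by (auto simp: A_def)
    then have "{z. F a z} \<noteq> {u}" using contra by blast
    then show ?thesis using u by blast
  qed
  then obtain b1 b2 where b12: "\<And>a. a \<in> A \<Longrightarrow> b1 a \<noteq> b2 a \<and> F a (b1 a) \<and> F a (b2 a)" by metis
  have bB: "b1 a \<in> B" "b2 a \<in> B" if "a \<in> A" for a using b12[OF that] F_low that by blast+
  \<comment> \<open>The low vertex and both high vertices must survive the same system, since their
    bags under \<open>c j\<close> are to be disjoint.\<close>
  define Aj where "Aj = (\<lambda>j. {a \<in> A. a \<notin> c j ` heavy_edges \<and> b1 a \<notin> c j ` heavy_edges \<and> b2 a \<notin> c j ` heavy_edges})"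
  have Aj: "card (Aj j) \<le> codegree_bound k * (density_bound k * card B)" if j: "j < 4" for j
  proof -
    have cj: "connector (c j)" using c j by simp
    define P where "P = (\<lambda>a. (b1 a, b2 a)) ` Aj j"
    have fAj: "finite (Aj j)" using fA by (simp add: Aj_def)
    have fP: "finite P" using fAj by (simp add: P_def)
    \<comment> \<open>One low vertex represents each pair that occurs; different pairs have
      different representatives, so the bags merged in \<open>b\<close> stay disjoint.\<close>
    define \<alpha> where "\<alpha> = inv_into (Aj j) (\<lambda>a. (b1 a, b2 a))"
    have \<alpha>: "\<alpha> p \<in> Aj j \<and> (b1 (\<alpha> p), b2 (\<alpha> p)) = p" if "p \<in> P" for p
      unfolding \<alpha>_def P_def using inv_into_into[of p "\<lambda>a. (b1 a, b2 a)" "Aj j"]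
        f_inv_into_f[of p "\<lambda>a. (b1 a, b2 a)" "Aj j"] that P_def by blast
    \<comment> \<open>The representative is absorbed by the first high vertex of its pair and
      thereby realises an edge to the second.\<close>
    define b where "b = (\<lambda>u. bag (c j) u \<union> (\<Union>p\<in>{p \<in> P. fst p = u}. bag (c j) (\<alpha> p)))"
    define G where "G = (\<lambda>u v. (u, v) \<in> P \<or> (v, u) \<in> P)"
    have \<alpha>A: "\<alpha> p \<in> classes - c j ` heavy_edges" "\<alpha> p \<in> A" if "p \<in> P" for p
      using \<alpha>[OF that] AX by (auto simp: Aj_def)
    have P: "qadj (\<alpha> (u, v)) u" "qadj (\<alpha> (u, v)) v" "u \<noteq> v" "u \<in> B - c j ` heavy_edges" "v \<in> B - c j ` heavy_edges"
      if "(u, v) \<in> P" for u v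
      using \<alpha>[OF that] b12[of "\<alpha> (u, v)"] FQ bB[of "\<alpha> (u, v)"]
      by (auto simp: Aj_def)
    let ?Bj = "B - c j ` heavy_edges"
    have "card (arcs_in ?Bj G) \<le> density_bound k * card ?Bj"
    proof (rule sparse_blow_up[where b = b])
      show "finite ?Bj" using fB by simp
      show "symp G" by (auto simp: G_def intro!: sympI)
      show "\<not> G x x" for x using P(3) by (auto simp: G_def)
      show "b y \<subseteq> V \<and> conn E (b y)" if "y \<in> ?Bj" for y
      proof
        show "b y \<subseteq> V" using bag_V[OF cj] by (auto simp: b_def)
        show "conn E (b y)"
          unfolding b_def
        proof (rule conn_attach[OF symE])
          show "conn E (bag (c j) y)" using conn_bag[OF cj] that BX by blast
          fix p assume p: "p \<in> {p \<in> P. fst p = y}"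
          then have "qadj (\<alpha> p) y" using P(1)[of "fst p" "snd p"] by (metis (mono_tags) mem_Collect_eq prod.collapse)
          then have "touch E (bag (c j) y) (bag (c j) (\<alpha> p))" using bag_touch qadj_sym by blast
          then show "conn E (bag (c j) (\<alpha> p)) \<and> touch E (bag (c j) y) (bag (c j) (\<alpha> p))"
            using conn_bag[OF cj] \<alpha>A p by blast
        qed
      qed
      show "touch E (b x) (b y)" if "G x y" for x y
      proof -
        have *: "touch E (b u) (b v)" if uv: "(u, v) \<in> P" for u v
        proof (rule touch_mono)
          show "touch E (bag (c j) (\<alpha> (u, v))) (bag (c j) v)" using bag_touch P(2) uv by blast
          show "bag (c j) (\<alpha> (u, v)) \<subseteq> b u" using uv by (auto simp: b_def)
          show "bag (c j) v \<subseteq> b v" by (auto simp: b_def)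
        qed
        then show ?thesis using that touch_sym[OF symE] unfolding G_def by blast
      qed
      show "disjoint_family_on b ?Bj"
        unfolding disjoint_family_on_def
      proof (intro ballI impI)
        fix u v assume uv: "u \<in> ?Bj" "v \<in> ?Bj" "u \<noteq> v"
        note dis = disjoint_family_onD[OF bag_disjoint[OF cj]]
        have d1: "bag (c j) u \<inter> bag (c j) v = {}" using dis uv BX by blast
        have d2: "bag (c j) w \<inter> bag (c j) (\<alpha> p) = {}" if "w \<in> ?Bj" "p \<in> P" for w p
          using dis[of w "\<alpha> p"] \<alpha>A[OF that(2)] AB that(1) BX by blast
        have d3: "bag (c j) (\<alpha> p) \<inter> bag (c j) (\<alpha> q) = {}" if "p \<in> P" "q \<in> P" "fst p \<noteq> fst q" for p q
        proof -
          have "\<alpha> p \<noteq> \<alpha> q" using \<alpha>[OF that(1)] \<alpha>[OF that(2)] that(3) by metis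
          then show ?thesis using dis[of "\<alpha> p" "\<alpha> q"] \<alpha>A that by blast
        qed
        have "w \<notin> b v" if wu: "w \<in> b u" for w
        proof
          assume wv: "w \<in> b v"
          consider "w \<in> bag (c j) u" | p where "p \<in> P" "fst p = u" "w \<in> bag (c j) (\<alpha> p)"
            using wu unfolding b_def by blast
          then show False
          proof cases
            case 1
            then show False using wv d1 d2 uv unfolding b_def by blast
          next
            case 2
            consider "w \<in> bag (c j) v" | q where "q \<in> P" "fst q = v" "w \<in> bag (c j) (\<alpha> q)"
              using wv unfolding b_def by blast
            then show False
            proof cases
              case 1
              then show False using 2 d2[OF uv(2) 2(1)] by blast
            next
              case q: 2
              then show False using 2 d3[OF 2(1) q(1)] uv(3) by blast
            qed
          qed
        qed
        then show "b u \<inter> b v = {}" by blast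
      qed
    qed
    also have "\<dots> \<le> density_bound k * card B" using fB by (intro mult_left_mono card_mono) auto
    finally have cG: "card (arcs_in ?Bj G) \<le> density_bound k * card B" .
    have "P \<subseteq> arcs_in ?Bj G"
    proof
      fix p assume "p \<in> P"
      then have "(fst p, snd p) \<in> P" by simp
      then have "(fst p, snd p) \<in> arcs_in ?Bj G"
        using P(4,5)[of "fst p" "snd p"] unfolding arcs_in_def G_def by blast
      then show "p \<in> arcs_in ?Bj G" by simp
    qed
    then have "card P \<le> card (arcs_in ?Bj G)" by (rule card_mono[rotated]) (use finite_arcs_in fB in auto)
    then have cP: "card P \<le> density_bound k * card B" using cG by simp
    have "Aj j \<subseteq> (\<Union>p\<in>P. {y. qadj (fst p) y \<and> qadj (snd p) y})"
    proof
      fix a assume a: "a \<in> Aj j"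
      then have "a \<in> A" by (simp add: Aj_def)
      then have "qadj (b1 a) a" "qadj (b2 a) a"
        using b12 FQ qadj_sym by blast+
      then show "a \<in> (\<Union>p\<in>P. {y. qadj (fst p) y \<and> qadj (snd p) y})"
        using a by (intro UN_I[of "(b1 a, b2 a)"]) (auto simp: P_def)
    qed
    then have "card (Aj j) \<le> card (\<Union>p\<in>P. {y. qadj (fst p) y \<and> qadj (snd p) y})"
      by (rule card_mono[rotated]) (use fP finite_classes in \<open>auto simp: qadj_def intro: finite_subset\<close>)
    also have "\<dots> \<le> (\<Sum>p\<in>P. card {y. qadj (fst p) y \<and> qadj (snd p) y})" by (rule card_UN_le[OF fP])
    also have "\<dots> \<le> (\<Sum>p\<in>P. codegree_bound k)"
    proof (rule sum_mono)
      fix p assume "p \<in> P"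
      then have "(fst p, snd p) \<in> P" by simp
      from P(3-5)[OF this] show "card {y. qadj (fst p) y \<and> qadj (snd p) y} \<le> codegree_bound k"
        using codegree BX by blast
    qed
    also have "\<dots> \<le> codegree_bound k * (density_bound k * card B)" using cP by simp
    finally show ?thesis .
  qed
  have "A \<subseteq> (\<Union>j<4. Aj j)" 
  proof
    fix a assume "a \<in> A"
    moreover obtain j where "j < 4" "a \<notin> c j ` heavy_edges" "b1 a \<notin> c j ` heavy_edges" "b2 a \<notin> c j ` heavy_edges"
      using free[of a "b1 a" "b2 a"] by blast
    ultimately show "a \<in> (\<Union>j<4. Aj j)" by (intro UN_I[of j]) (simp_all add: Aj_def)
  qed
  then have "card A \<le> card (\<Union>j<4. Aj j)" by (rule card_mono[rotated]) (use fA in \<open>auto simp: Aj_def\<close>)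
  also have "\<dots> \<le> (\<Sum>j<4. card (Aj j))" by (rule card_UN_le) simp
  also have "\<dots> \<le> (\<Sum>j<(4::nat). codegree_bound k * (density_bound k * card B))" by (intro sum_mono Aj) simp
  finally have cA: "card A \<le> 4 * codegree_bound k * density_bound k * card B" by simp
  \<comment> \<open>The degrees of the high vertices are weighed against the sparsity of the whole
    graph; the surplus of one per high vertex forces \<open>B\<close> to be empty.\<close>
  have "(light_bound k + 1) * card B = (\<Sum>x\<in>B. light_bound k + 1)" by simp
  also have "\<dots> \<le> (\<Sum>x\<in>B. card {z. F x z})" by (intro sum_mono) (simp add: B_def)
  also have "\<dots> = card (SIGMA x:B. {z. F x z})" using fB finN by simp
  also have "\<dots> \<le> card (arcs_in ?Y F)"
  proof (rule card_mono)
    show "finite (arcs_in ?Y F)" using finite_arcs_in fA fB by blast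
    show "(SIGMA x:B. {z. F x z}) \<subseteq> arcs_in ?Y F" using FAB sym by (auto simp: arcs_in_def)
  qed
  also have "\<dots> \<le> 4 * density_bound k * card ?Y" by (rule arcs)
  also have "\<dots> = 4 * density_bound k * (card A + card B)" using fA fB AB by (simp add: card_Un_disjoint)
  also have "\<dots> \<le> 4 * density_bound k * (4 * codegree_bound k * density_bound k * card B + card B)"
    by (intro mult_left_mono add_right_mono cA) simp
  also have "\<dots> = light_bound k * card B" by (simp add: light_bound_def algebra_simps)
  finally have "card B = 0" by simp
  then show False using Bne fB by simp
qed

text \<open>Neighbours in \<open>hubs\<close> are few by \<open>hubs_degree\<close>. The others are
  singleton classes, so they are distinct neighbours of the class of \<open>v\<close> in the
  quotient, where the defect is at most \<open>light_bound k\<close>.\<close>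

lemma defective_two_colouring:
  "\<exists>f :: 'a \<Rightarrow> bool. \<forall>v\<in>V. card {w \<in> V. E v w \<and> f w = f v} \<le> hub_degree k + light_bound k"
proof -
  have "finite {(x, y). qadj x y}"
    by (rule finite_subset[of _ "classes \<times> classes"]) (use finite_classes in \<open>auto simp: qadj_def\<close>)
  moreover have "\<not> qadj x x" for x by (simp add: qadj_def)
  moreover have "symp qadj" using qadj_sym by (auto intro!: sympI)
  ultimately obtain c :: "'a \<Rightarrow> bool" where c: "\<And>x. card {y. qadj x y \<and> c y = c x} \<le> light_bound k"
    using light_colouring[of qadj "light_bound k" qadj] light_edge by blast
  have "card {w \<in> V. E v w \<and> c (rep w) = c (rep v)} \<le> hub_degree k + light_bound k" if v: "v \<in> V" for v
  proof -
    let ?P = "{y. qadj (rep v) y \<and> c y = c (rep v)}"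
    have "w \<in> ?P" if "w \<in> V" "E v w" "c (rep w) = c (rep v)" "w \<notin> hubs" for w
    proof -
      have w: "rep w = w" "w \<in> classes" using that by (auto simp: classes_def image_iff intro: bexI[of _ w])
      moreover have "rep v \<noteq> w"
      proof
        assume "rep v = w"
        then have "v \<notin> hubs" using that(4) by auto
        then show False using \<open>rep v = w\<close> that(2) irrE by simp
      qed
      moreover have "touch E (cl (rep v)) (cl w)"
        unfolding touch_def using that v w(1) by (intro bexI[of _ v] bexI[of _ w]) (simp_all add: cl_def)
      ultimately show ?thesis using that v by (auto simp: qadj_def classes_def)
    qed
    then have "{w \<in> V. E v w \<and> c (rep w) = c (rep v)} \<subseteq> {w \<in> hubs. E v w} \<union> ?P" by blast
    moreover have "finite ?P" using finite_classes by (auto simp: qadj_def intro: finite_subset)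
    ultimately have "card {w \<in> V. E v w \<and> c (rep w) = c (rep v)} \<le> card ({w \<in> hubs. E v w} \<union> ?P)"
      using finite_hubs by (intro card_mono) auto
    also have "\<dots> \<le> card {w \<in> hubs. E v w} + card ?P" by (rule card_Un_le)
    also have "\<dots> \<le> hub_degree k + light_bound k" using hubs_degree[OF v] c[of "rep v"] by linarith
    finally show ?thesis .
  qed
  then show ?thesis by (intro exI[of _ "\<lambda>v. c (rep v)"]) blast
qed

end

theorem (in fan_free) two_colouring:
  "\<exists>f :: 'a \<Rightarrow> bool. \<forall>v\<in>V. card {w \<in> V. E v w \<and> f w = f v} \<le> hub_degree k + light_bound k"
proof -
  obtain D where "reserve_on heavy_edges D" using ex_reserve by blast
  then interpret fan_reserved V E k D by unfold_locales
  show ?thesis by (rule defective_two_colouring)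
qed


section \<open>Rooted trees and tree-depth\<close>

context
  fixes T :: "('a, 'b) pre_digraph" and r :: 'a
  assumes T: "rooted_tree T r"
begin

interpretation graph T using T by (simp add: rooted_tree_def)

definition root_path :: "'a \<Rightarrow> 'b list" where
  "root_path v = (THE p. apath r p v)"

lemma root_in_verts: "r \<in> verts T"
  using T by (simp add: rooted_tree_def)

lemma ex1_root_path: "v \<in> verts T \<Longrightarrow> \<exists>!p. apath r p v"
  using T root_in_verts unfolding rooted_tree_def by blast

lemma root_path: "v \<in> verts T \<Longrightarrow> apath r (root_path v) v"
  unfolding root_path_def by (rule theI') (rule ex1_root_path)

lemma root_path_eqI: "apath r p v \<Longrightarrow> root_path v = p"
  using ex1_root_path[of v] root_path[of v] by (metis apath_def awalk_last_in_verts)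

lemma ancestor_iff:
  "ancestor T r u v \<longleftrightarrow> v \<in> verts T \<and> u \<in> set (awalk_verts r (root_path v))"
proof
  assume "ancestor T r u v"
  then obtain p where p: "apath r p v" "u \<in> set (awalk_verts r p)" by (auto simp: ancestor_def)
  then have "v \<in> verts T" by (metis apath_def awalk_last_in_verts)
  then show "v \<in> verts T \<and> u \<in> set (awalk_verts r (root_path v))"
    using p root_path_eqI by metis
next
  assume "v \<in> verts T \<and> u \<in> set (awalk_verts r (root_path v))"
  then show "ancestor T r u v" unfolding ancestor_def using root_path by blast
qed

text \<open>An initial part of a path without repeated vertices is again such a path, so by
  uniqueness it is the root path of its endpoint: ancestors correspond to prefixes.\<close>

lemma ancestor_decomp:
  assumes "ancestor T r u v"
  obtains q where "u \<in> verts T" "v \<in> verts T" "root_path v = root_path u @ q" "awalk u q v"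
proof -
  have v: "v \<in> verts T" "u \<in> set (awalk_verts r (root_path v))"
    using assms by (simp_all add: ancestor_iff)
  have ap: "apath r (root_path v) v" by (rule root_path[OF v(1)])
  then obtain p q where pq: "root_path v = p @ q" "awalk r p u" "awalk u q v"
    using awalk_decomp[OF awalkI_apath v(2)] by blast
  have "apath r p (awlast r p)" using ap pq(1) by (simp add: apath_append_iff)
  then have "root_path u = p" using pq(2) by (intro root_path_eqI) auto
  then show ?thesis using that pq v(1) by auto
qed

lemma ancestor_length:
  assumes "ancestor T r u v" "u \<noteq> v"
  shows "length (root_path u) < length (root_path v)"
proof -
  obtain q where q: "root_path v = root_path u @ q" "awalk u q v"
    using ancestor_decomp[OF assms(1)] by metis
  have "q \<noteq> []" using q(2) assms(2) awalk_empty_ends by blast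
  then show ?thesis using q(1) by simp
qed

lemma ancestor_refl: "v \<in> verts T \<Longrightarrow> ancestor T r v v"
proof -
  assume v: "v \<in> verts T"
  have "awlast r (root_path v) = v" using awalkI_apath[OF root_path[OF v]] by simp
  moreover have "awalk_verts r (root_path v) \<noteq> []"
    using length_awalk_verts[of r "root_path v"] by auto
  ultimately show "ancestor T r v v" unfolding ancestor_iff using v last_in_set by metis
qed

lemma ancestor_trans:
  assumes "ancestor T r u v" "ancestor T r v w"
  shows "ancestor T r u w"
proof -
  obtain q where q: "w \<in> verts T" "root_path w = root_path v @ q" "awalk v q w" "v \<in> verts T"
    using ancestor_decomp[OF assms(2)] by metis
  have "set (awalk_verts r (root_path w)) = set (awalk_verts r (root_path v)) \<union> set (awalk_verts v q)"
    unfolding q(2) by (rule set_awalk_verts_append) (use q root_path awalkI_apath in auto)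
  then show ?thesis using assms(1) q(1) by (simp add: ancestor_iff)
qed

text \<open>\<open>tree_height\<close> looks at leaves only, so \<open>v\<close> is followed down to
  a deepest descendant, which is a leaf. The inequality is strict because height counts vertices
  while a path is a list of arcs.\<close>

lemma length_root_path:
  assumes "v \<in> verts T"
  shows "length (root_path v) < tree_height T r"
proof -
  let ?D = "{w. ancestor T r v w}"
  have DV: "?D \<subseteq> verts T" by (auto simp: ancestor_iff)
  then have finD: "finite ?D" using finite_verts finite_subset by blast
  have "?D \<noteq> {}" using ancestor_refl[OF assms] by blast
  then obtain w where w: "w \<in> ?D" "length (root_path w) = Max ((\<lambda>x. length (root_path x)) ` ?D)"
    using obtains_MAX[OF finD] by metis
  have wmax: "length (root_path x) \<le> length (root_path w)" if "x \<in> ?D" for x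
    unfolding w(2) using finD that by (intro Max_ge) auto
  have "leaf T r w"
    unfolding leaf_def
  proof (intro conjI allI impI)
    show "w \<in> verts T" using w DV by blast
    fix x assume x: "ancestor T r w x"
    then have "x \<in> ?D" using ancestor_trans w(1) by blast
    then show "x = w" using ancestor_length[OF x] wmax[of x] by force
  qed
  let ?H = "{length (awalk_verts r p) | p l. leaf T r l \<and> apath r p l}"
  have "?H \<subseteq> (\<lambda>l. Suc (length (root_path l))) ` verts T"
    using root_path_eqI by (auto simp: leaf_def length_awalk_verts)
  then have "finite ?H" using finite_verts finite_surj by blast
  moreover have "length (awalk_verts r (root_path w)) \<in> ?H"
    using \<open>leaf T r w\<close> root_path[of w] w DV by blast
  ultimately have "Suc (length (root_path w)) \<le> tree_height T r"
    unfolding tree_height_def using Max_ge[of ?H] by (simp add: length_awalk_verts)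
  moreover have "length (root_path v) \<le> length (root_path w)"
    using wmax ancestor_refl[OF assms] by blast
  ultimately show ?thesis by simp
qed

lemma root_path_Nil_iff: "v \<in> verts T \<Longrightarrow> root_path v = [] \<longleftrightarrow> v = r"
  using root_path[of v] root_path_eqI[of "[]" r] root_in_verts by (auto simp: apath_Nil_iff)

lemma closure_cases:
  assumes "(u, v) \<in> parcs (tree_closure T r)"
  obtains "ancestor T r u v" "u \<noteq> v" | "ancestor T r v u" "u \<noteq> v"
  using assms by (auto simp: tree_closure_def)

lemma closure_height_2:
  assumes "tree_height T r \<le> 2" "(u, v) \<in> parcs (tree_closure T r)"
  shows "u = r \<or> v = r"
proof -
  have "u = r" if "ancestor T r u v" "u \<noteq> v" for u v
  proof -
    have "u \<in> verts T" "v \<in> verts T" using ancestor_decomp[OF that(1)] by metis+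
    moreover from this have "length (root_path u) = 0"
      using ancestor_length[OF that] length_root_path[of v] assms(1) by linarith
    ultimately show ?thesis using root_path_Nil_iff[of u] by simp
  qed
  then show ?thesis using closure_cases[OF assms(2)] by metis
qed

text \<open>Away from the root only depths 1 and 2 remain. Depth 1 gives the centres, and the first
  arc of the root path of a deeper vertex ends in its centre.\<close>

lemma closure_height_3:
  assumes "tree_height T r \<le> 3"
  obtains cen par where "\<And>u v. (u, v) \<in> parcs (tree_closure T r) \<Longrightarrow> u \<noteq> r \<Longrightarrow> v \<noteq> r \<Longrightarrow>
     cen u \<and> \<not> cen v \<and> par v = u \<or> cen v \<and> \<not> cen u \<and> par u = v"
proof -
  define cen where "cen = (\<lambda>v. length (root_path v) = 1)"
  define par where "par = (\<lambda>v. THE u. apath r (take 1 (root_path v)) u)"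
  have *: "cen u \<and> \<not> cen v \<and> par v = u" if anc: "ancestor T r u v" "u \<noteq> v" "u \<noteq> r" for u v
  proof -
    obtain q where q: "u \<in> verts T" "v \<in> verts T" "root_path v = root_path u @ q"
      using ancestor_decomp[OF anc(1)] by metis
    have "length (root_path u) \<noteq> 0" using root_path_Nil_iff[OF q(1)] anc(3) by simp
    then have l: "length (root_path u) = 1" "length (root_path v) = 2"
      using ancestor_length[OF anc(1,2)] length_root_path[OF q(2)] assms by linarith+
    then have "take 1 (root_path v) = root_path u" using q(3) by simp
    moreover have "(THE w. apath r (root_path u) w) = u"
    proof (rule the_equality)
      show "apath r (root_path u) u" by (rule root_path[OF q(1)])
      then show "w = u" if "apath r (root_path u) w" for w using apath_ends[OF _ that] by blast
    qed
    ultimately show ?thesis using l by (simp add: cen_def par_def)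
  qed
  show ?thesis
  proof (rule that)
    fix u v assume "(u, v) \<in> parcs (tree_closure T r)" "u \<noteq> r" "v \<noteq> r"
    then show "cen u \<and> \<not> cen v \<and> par v = u \<or> cen v \<and> \<not> cen u \<and> par u = v"
      using closure_cases[of u v] * by metis
  qed
qed

end

text \<open>The arcs of \<open>C\<close> have an arbitrary type; renaming each one to the pair of
  images of its ends is injective because parallel arcs are excluded.\<close>

lemma closure_embedding:
  fixes T :: "(nat, nat \<times> nat) pre_digraph"
  assumes T: "rooted_tree T r" and C: "digraph C"
    and f: "inj_on f (verts C)" "f ` verts C \<subseteq> verts T"
    and arcs: "\<And>u v. u \<rightarrow>\<^bsub>C\<^esub> v \<Longrightarrow> (f u, f v) \<in> parcs (tree_closure T r)"
  shows "\<exists>S. subgraph S (with_proj (tree_closure T r)) \<and> digraph_iso C S"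
proof -
  interpret C: digraph C by (rule C)
  define h where "h = \<lparr>iso_verts = f, iso_arcs = (\<lambda>a. (f (tail C a), f (head C a))),
     iso_head = snd, iso_tail = fst\<rparr>"
  have h: "C.digraph_isomorphism h"
    unfolding C.digraph_isomorphism_def h_def
  proof (simp add: C.wf_digraph_axioms f(1), rule inj_onI)
    fix a b assume ab: "a \<in> arcs C" "b \<in> arcs C" "(f (tail C a), f (head C a)) = (f (tail C b), f (head C b))"
    then have "arc_to_ends C a = arc_to_ends C b"
      using f(1) by (auto simp: arc_to_ends_def inj_on_eq_iff)
    then show "a = b" using C.no_multi_arcs ab by blast
  qed
  let ?S = "app_iso h C"
  have anc: "u \<in> verts T \<and> v \<in> verts T" if "ancestor T r u v" for u v
    using ancestor_decomp[OF T that] by metis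
  have "subgraph ?S (with_proj (tree_closure T r))"
  proof (rule subgraphI)
    show "verts ?S \<subseteq> verts (with_proj (tree_closure T r))" using f by (auto simp: h_def tree_closure_def)
    show "arcs ?S \<subseteq> arcs (with_proj (tree_closure T r))"
      using arcs by (auto simp: h_def arcs_ends_conv)
    show "compatible (with_proj (tree_closure T r)) ?S" by (simp add: compatible_def h_def)
    show "wf_digraph ?S" by (rule C.wf_digraphI_app_iso[OF h])
    show "wf_digraph (with_proj (tree_closure T r))"
      by unfold_locales (use anc in \<open>auto simp: tree_closure_def\<close>)
  qed
  then show ?thesis using h unfolding digraph_iso_def by blast
qed

text \<open>The tree on \<open>{..<m}\<close> in which \<open>p i < i\<close> is the parent of \<open>i > 0\<close>.\<close>

definition ptree :: "(nat \<Rightarrow> nat) \<Rightarrow> nat \<Rightarrow> (nat, nat \<times> nat) pre_digraph" where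
  "ptree p m = \<lparr>verts = {..<m}, arcs = {(i, j). i < m \<and> j < m \<and> (0 < i \<and> j = p i \<or> 0 < j \<and> i = p j)},
     tail = fst, head = snd\<rparr>"

lemma ptree_simps [simp]:
  "verts (ptree p m) = {..<m}" "tail (ptree p m) = fst" "head (ptree p m) = snd"
  "arcs (ptree p m) = {(i, j). i < m \<and> j < m \<and> (0 < i \<and> j = p i \<or> 0 < j \<and> i = p j)}"
  by (simp_all add: ptree_def)

lemma graph_ptree:
  assumes "\<And>i. 0 < i \<Longrightarrow> p i < i"
  shows "graph (ptree p m)"
proof
  show "finite (arcs (ptree p m))" by (rule finite_subset[of _ "{..<m} \<times> {..<m}"]) auto
  show "symmetric (ptree p m)" by (auto simp: symmetric_def sym_def arcs_ends_conv)
  show "tail (ptree p m) e \<noteq> head (ptree p m) e" if "e \<in> arcs (ptree p m)" for e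
    using that assms[of "fst e"] assms[of "snd e"] by (cases e) auto
qed (auto simp: arc_to_ends_def)

text \<open>Induction on the number of vertices: the newest vertex \<open>m\<close> is attached to
  \<open>q = p m\<close> alone, so paths between old vertices avoid it, and paths from or to it
  extend old paths from or to \<open>q\<close> by one arc.\<close>

lemma ptree_unique_paths:
  assumes p: "\<And>i. 0 < i \<Longrightarrow> p i < i"
  shows "u < m \<Longrightarrow> v < m \<Longrightarrow> \<exists>!w. pre_digraph.apath (ptree p m) u w v"
proof (induction m arbitrary: u v)
  case 0
  then show ?case by simp
next
  case (Suc m)
  interpret T: graph "ptree p m" by (rule graph_ptree[OF p])
  interpret T': graph "ptree p (Suc m)" by (rule graph_ptree[OF p])
  show ?case
  proof (cases "m = 0")
    case True
    have "T'.apath 0 w 0 \<longleftrightarrow> w = []" for w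
      using T'.apath_nonempty_ends[of 0 w 0] by (auto simp: T'.apath_Nil_iff)
    then show ?thesis using Suc.prems True by simp
  next
    case False
    define q where "q = p m"
    have q: "q < m" using p False by (simp add: q_def)
    have sub: "subgraph (ptree p m) (ptree p (Suc m))"
      by (rule subgraphI) (auto simp: compatible_def T.wf_digraph_axioms T'.wf_digraph_axioms)
    have up: "T'.apath u w v" if "T.apath u w v" for u w v
      by (rule T'.subgraph_apath_imp_apath[OF that sub])
    have av: "T.awalk_verts = T'.awalk_verts"
      by (rule compatible_awalk_verts) (simp add: compatible_def)
    have arcm: "(i, m) \<in> arcs (ptree p (Suc m)) \<longleftrightarrow> i = q" "(m, i) \<in> arcs (ptree p (Suc m)) \<longleftrightarrow> i = q" for i
      using p q False by (auto simp: q_def dest: less_imp_neq) (metis less_not_sym not_gr_zero not_less_eq)+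
    have arc': "e \<in> arcs (ptree p m)" if "e \<in> arcs (ptree p (Suc m))" "fst e \<noteq> m" "snd e \<noteq> m" for e
      using that by (auto simp: less_Suc_eq)
    have down: "T.apath u w v" if "T'.apath u w v" "m \<notin> set (T'.awalk_verts u w)" for u w v
      using that
    proof (induction w arbitrary: u)
      case Nil
      then show ?case by (auto simp: T.apath_Nil_iff T'.apath_Nil_iff less_Suc_eq)
    next
      case (Cons e w)
      then have e: "e \<in> arcs (ptree p (Suc m))" "fst e = u" "T'.apath (snd e) w v"
        "u \<notin> set (T'.awalk_verts (snd e) w)"
        by (auto simp: T'.apath_Cons_iff)
      have m: "m \<noteq> u" "m \<notin> set (T'.awalk_verts (snd e) w)" using Cons.prems(2) e(2) by auto
      have "snd e \<in> set (T'.awalk_verts (snd e) w)" using T'.hd_in_awalk_verts(2)[OF e(3)] .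
      then have "snd e \<noteq> m" using m by metis
      then have "e \<in> arcs (ptree p m)" using arc'[OF e(1)] e(2) m(1) by simp
      then show ?case using Cons.IH[OF e(3) m(2)] e by (simp add: T.apath_Cons_iff av)
    qed
    \<comment> \<open>Entering and leaving \<open>m\<close> both pass through \<open>q\<close>,
      which would then be visited twice.\<close>
    have avoid: "m \<notin> set (T'.awalk_verts u w)" if w: "T'.apath u w v" and uv: "u < m" "v < m" for u v w
    proof
      assume "m \<in> set (T'.awalk_verts u w)"
      then obtain w1 w2 where d: "w = w1 @ w2" "T'.awalk u w1 m" "T'.awalk m w2 v"
        using T'.awalk_decomp[OF T'.awalkI_apath[OF w]] by blast
      have "w1 \<noteq> []" using d(2) uv by (auto simp: T'.awalk_Nil_iff)
      then obtain w1' e where w1: "w1 = w1' @ [e]" by (metis rev_exhaust)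
      have "w2 \<noteq> []" using d(3) uv by (auto simp: T'.awalk_Nil_iff)
      then obtain e' w2' where w2: "w2 = e' # w2'" by (metis list.exhaust)
      have "T'.awalk (T'.awlast u w1') [e] m" using d(2) unfolding w1 by (metis T'.awalk_append_iff T'.awends_of_awalk(2) T'.awlast_append)
      then have e: "e \<in> arcs (ptree p (Suc m))" "snd e = m" "fst e = T'.awlast u w1'"
        by (auto simp: T'.awalk_simps)
      then have "fst e = q" using arcm(1)[of "fst e"] by (metis prod.collapse)
      have e': "e' \<in> arcs (ptree p (Suc m))" "fst e' = m" "T'.awalk (snd e') w2' v"
        using d(3) unfolding w2 by (auto simp: T'.awalk_simps)
      then have "snd e' = q" using arcm(2)[of "snd e'"] by (metis prod.collapse)
      have "q \<in> set (T'.awalk_verts u w1)"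
        using T'.awalk_verts_arc1[of e w1 u] w1 \<open>fst e = q\<close> by simp
      moreover have "q \<in> set (tl (T'.awalk_verts (T'.awlast u w1) w2))"
        using T'.awalk_hd_in_verts[OF e'(3)] T'.hd_in_awalk_verts(1)[OF e'(3)] \<open>snd e' = q\<close>
        unfolding w2 by simp
      ultimately show False using w unfolding d(1) T'.apath_append_iff by blast
    qed
    have old: "T'.apath u w v \<longleftrightarrow> T.apath u w v" if "u < m" "v < m" for u v w
      using up down avoid that by blast
    have from_m: "T'.apath m w v \<longleftrightarrow> (\<exists>w'. w = (m, q) # w' \<and> T.apath q w' v)" if v: "v < m" for w v
    proof
      assume w: "T'.apath m w v"
      then have "w \<noteq> []" using v by (auto simp: T'.apath_Nil_iff)
      then obtain e w' where e: "w = e # w'" by (metis list.exhaust)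
      then have *: "e \<in> arcs (ptree p (Suc m))" "fst e = m" "T'.apath (snd e) w' v"
        using w by (auto simp: T'.apath_Cons_iff)
      then have "snd e = q" using arcm(2)[of "snd e"] by (metis prod.collapse)
      then have "e = (m, q)" "T.apath q w' v" using * old[OF q v] by (auto simp: prod_eq_iff)
      then show "\<exists>w'. w = (m, q) # w' \<and> T.apath q w' v" using e by blast
    next
      assume "\<exists>w'. w = (m, q) # w' \<and> T.apath q w' v"
      then obtain w' where w': "w = (m, q) # w'" "T.apath q w' v" by blast
      have "T'.apath q w' v" using up w' by blast
      moreover have "m \<notin> set (T'.awalk_verts q w')" by (rule avoid[OF calculation q v])
      moreover have "(m, q) \<in> arcs (ptree p (Suc m))" using arcm(2) by blast
      ultimately show "T'.apath m w v" unfolding w'(1) T'.apath_Cons_iff by simp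
    qed
    have to_m: "T'.apath u w m \<longleftrightarrow> (\<exists>w'. w = w' @ [(q, m)] \<and> T.apath u w' q)" if u: "u < m" for w u
    proof
      assume w: "T'.apath u w m"
      then have "w \<noteq> []" using u by (auto simp: T'.apath_Nil_iff)
      then obtain w' e where e: "w = w' @ [e]" by (metis rev_exhaust)
      then have *: "T'.apath u w' (T'.awlast u w')" "T'.apath (T'.awlast u w') [e] m"
        using w by (auto simp: T'.apath_append_iff)
      then have **: "e \<in> arcs (ptree p (Suc m))" "fst e = T'.awlast u w'" "snd e = m"
        by (auto simp: T'.apath_simps)
      then have "fst e = q" using arcm(1)[of "fst e"] by (metis prod.collapse)
      then have "e = (q, m)" "T.apath u w' q" using * ** old[OF u q] by (auto simp: prod_eq_iff)
      then show "\<exists>w'. w = w' @ [(q, m)] \<and> T.apath u w' q" using e by blast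
    next
      assume "\<exists>w'. w = w' @ [(q, m)] \<and> T.apath u w' q"
      then obtain w' where w': "w = w' @ [(q, m)]" "T.apath u w' q" by blast
      have 1: "T'.apath u w' q" using up w' by blast
      have 2: "m \<notin> set (T'.awalk_verts u w')" by (rule avoid[OF 1 u q])
      have 3: "T'.awlast u w' = q" using 1 by (elim T'.awalkE'[OF T'.awalkI_apath])
      have "(q, m) \<in> arcs (ptree p (Suc m))" using arcm(1) by blast
      then have "T'.apath q [(q, m)] m" using q by (simp add: T'.apath_simps)
      then show "T'.apath u w m" unfolding w'(1) T'.apath_append_iff 3 using 1 2 by simp
    qed
    have mm: "T'.apath m w m \<longleftrightarrow> w = []" for w
      using T'.apath_nonempty_ends[of m w m] by (auto simp: T'.apath_Nil_iff)
    consider "u < m" "v < m" | "u = m" "v < m" | "u < m" "v = m" | "u = m" "v = m"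
      using Suc.prems by linarith
    then show ?thesis
    proof cases
      case 1
      then show ?thesis using Suc.IH[OF 1] old by simp
    next
      case 2
      then show ?thesis using Suc.IH[OF q 2(2)] from_m[OF 2(2)] by auto
    next
      case 3
      then show ?thesis using Suc.IH[OF 3(1) q] to_m[OF 3(1)] by auto
    next
      case 4
      then show ?thesis using mm by simp
    qed
  qed
qed

lemma rooted_tree_ptree:
  assumes "\<And>i. 0 < i \<Longrightarrow> p i < i" "0 < m"
  shows "rooted_tree (ptree p m) 0"
  unfolding rooted_tree_def using graph_ptree[OF assms(1)] ptree_unique_paths[OF assms(1)] assms(2) by simp

lemma star_height:
  assumes "0 < m"
  shows "tree_height (ptree (\<lambda>_. 0) m) 0 \<le> 2"
proof -
  let ?T = "ptree (\<lambda>_. 0) m"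
  have T: "rooted_tree ?T 0" by (rule rooted_tree_ptree) (use assms in auto)
  interpret T: graph ?T using T by (simp add: rooted_tree_def)
  have path: "length p \<le> 1" if "T.apath 0 p l" for p l
  proof -
    have l: "l < m" using T.awalk_last_in_verts[OF T.awalkI_apath[OF that]] by simp
    have "\<exists>p'. T.apath 0 p' l \<and> length p' \<le> 1"
    proof (cases "l = 0")
      case True
      then show ?thesis using assms by (intro exI[of _ "[]"]) (simp add: T.apath_Nil_iff)
    next
      case False
      then show ?thesis using l by (intro exI[of _ "[(0, l)]"]) (simp add: T.apath_simps)
    qed
    then show ?thesis using root_path_eqI[OF T] that by metis
  qed
  let ?H = "{length (T.awalk_verts 0 p) | p l. leaf ?T 0 l \<and> T.apath 0 p l}"
  have H: "?H \<subseteq> {..2}"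
    using path by (fastforce simp: T.length_awalk_verts)
  \<comment> \<open>The bound on \<open>Max\<close> needs a nonempty set, hence a leaf; in the
    one-vertex tree it is the root.\<close>
  have "\<exists>l. leaf ?T 0 l"
  proof (cases "m = 1")
    case True
    have "leaf ?T 0 0" unfolding leaf_def using ancestor_decomp[OF T] True by (metis lessThan_iff less_one ptree_simps(1))
    then show ?thesis by blast
  next
    case False
    then have m: "1 < m" using assms by simp
    have "v = 1" if v: "ancestor ?T 0 1 v" for v
    proof (rule ccontr)
      assume "v \<noteq> 1"
      then have "length (root_path ?T 0 1) < length (root_path ?T 0 v)"
        using ancestor_length[OF T v] by simp
      moreover have "length (root_path ?T 0 v) \<le> 1"
        using path root_path[OF T] ancestor_decomp[OF T v] by metis
      ultimately have "length (root_path ?T 0 1) = 0" by linarith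
      then show False using root_path_Nil_iff[OF T, of 1] m by simp
    qed
    then have "leaf ?T 0 1" unfolding leaf_def using m by auto
    then show ?thesis by blast
  qed
  then have "?H \<noteq> {}" using root_path[OF T] unfolding leaf_def by blast
  then show ?thesis unfolding tree_height_def using H finite_subset[OF H]
    by (subst Max_le_iff) auto
qed

lemma star_ancestor:
  assumes "0 < m" "v < m"
  shows "ancestor (ptree (\<lambda>_. 0) m) 0 0 v"
proof -
  have T: "rooted_tree (ptree (\<lambda>_. 0) m) 0" by (rule rooted_tree_ptree) (use assms in auto)
  interpret T: graph "ptree (\<lambda>_. 0) m" using T by (simp add: rooted_tree_def)
  show ?thesis
    using root_path[OF T, of v] assms(2) T.hd_in_awalk_verts(2) unfolding ancestor_def by fastforce
qed

lemma path_ancestor: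
  assumes "u \<le> v" "v < m"
  shows "ancestor (ptree (\<lambda>i. i - 1) m) 0 u v"
proof -
  define pre where "pre = (\<lambda>i::nat. i - 1)"
  have pre: "pre (Suc i) = i" for i by (simp add: pre_def)
  have T: "rooted_tree (ptree pre m) 0" by (rule rooted_tree_ptree) (use assms in \<open>auto simp: pre_def\<close>)
  interpret T: graph "ptree pre m" using T by (simp add: rooted_tree_def)
  have "\<exists>p. T.apath 0 p v \<and> set (T.awalk_verts 0 p) = {..v}"
    using assms(2)
  proof (induction v)
    case 0
    then show ?case by (intro exI[of _ "[]"]) (simp add: T.apath_Nil_iff T.awalk_verts.simps atMost_0)
  next
    case (Suc v)
    then obtain p where p: "T.apath 0 p v" "set (T.awalk_verts 0 p) = {..v}" by auto
    have last: "T.awlast 0 p = v" using p(1) by (elim T.awalkE'[OF T.awalkI_apath])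
    have e: "T.apath v [(v, Suc v)] (Suc v)" using Suc.prems by (simp add: T.apath_simps pre T.awalk_verts.simps)
    have "T.apath 0 (p @ [(v, Suc v)]) (Suc v)"
      unfolding T.apath_append_iff last using p e by simp
    moreover have "set (T.awalk_verts 0 (p @ [(v, Suc v)])) = {..Suc v}"
      using T.set_awalk_verts_append[OF T.awalkI_apath[OF p(1)] T.awalkI_apath[OF e]] p(2) by auto
    ultimately show ?case by blast
  qed
  then show ?thesis unfolding ancestor_def pre_def[symmetric] using assms(1) by blast
qed


section \<open>Excluding a graph of tree-depth 3\<close>

lemma closure_pullback:
  assumes "subgraph S (with_proj (tree_closure T r))" "digraph_iso C S"
  obtains f where "inj_on f (verts C)" "\<And>u v. u \<rightarrow>\<^bsub>C\<^esub> v \<Longrightarrow> (f u, f v) \<in> parcs (tree_closure T r)"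
proof -
  obtain h where h: "pre_digraph.digraph_isomorphism C h" "S = app_iso h C"
    using assms(2) unfolding digraph_iso_def by blast
  have S: "arcs S \<subseteq> parcs (tree_closure T r)" "tail S = fst" "head S = snd"
    using assms(1) by (auto simp: subgraph_def compatible_def)
  show ?thesis
  proof (rule that)
    show "inj_on (iso_verts h) (verts C)" using h(1) by (simp add: pre_digraph.digraph_isomorphism_def)
    fix u v assume "u \<rightarrow>\<^bsub>C\<^esub> v"
    then obtain a where a: "a \<in> arcs C" "tail C a = u" "head C a = v" by (auto simp: arcs_ends_conv)
    then have "iso_verts h u = fst (iso_arcs h a)" "iso_verts h v = snd (iso_arcs h a)"
      using h S(2,3) unfolding pre_digraph.digraph_isomorphism_def by auto
    moreover have "iso_arcs h a \<in> parcs (tree_closure T r)" using S(1) h(2) a(1) by auto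
    ultimately show "(iso_verts h u, iso_verts h v) \<in> parcs (tree_closure T r)" by simp
  qed
qed

text \<open>A path rooted at an end shows that the set whose least element is taken is nonempty.\<close>

lemma connected_tree_depth_witness:
  assumes C: "digraph C" "verts C \<noteq> {}"
  obtains T :: "(nat, nat \<times> nat) pre_digraph" and r f where
    "rooted_tree T r" "tree_height T r = connected_tree_depth C" "inj_on f (verts C)"
    "\<And>u v. u \<rightarrow>\<^bsub>C\<^esub> v \<Longrightarrow> (f u, f v) \<in> parcs (tree_closure T r)"
proof -
  interpret digraph C by (rule C)
  let ?P = "\<lambda>h. \<exists>(T :: (nat, nat \<times> nat) pre_digraph) r S. rooted_tree T r \<and> tree_height T r = h \<and>
        subgraph S (with_proj (tree_closure T r)) \<and> digraph_iso C S"
  define m where "m = card (verts C)"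
  have m: "0 < m" using C(2) finite_verts by (simp add: m_def card_gt_0_iff)
  let ?T = "ptree (\<lambda>i. i - 1) m"
  have T: "rooted_tree ?T 0" by (rule rooted_tree_ptree) (use m in auto)
  obtain f where f: "bij_betw f (verts C) {..<m}"
    using ex_bij_betw_finite_nat[OF finite_verts] by (auto simp: m_def atLeast0LessThan)
  have "\<exists>S. subgraph S (with_proj (tree_closure ?T 0)) \<and> digraph_iso C S"
  proof (rule closure_embedding[OF T C(1)])
    show "inj_on f (verts C)" "f ` verts C \<subseteq> verts ?T" using f by (auto simp: bij_betw_def)
    fix u v assume uv: "u \<rightarrow>\<^bsub>C\<^esub> v"
    then have "u \<in> verts C" "v \<in> verts C" "u \<noteq> v" using adj_not_same by auto
    then have "f u < m" "f v < m" "f u \<noteq> f v" using f by (auto simp: bij_betw_def inj_on_def)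
    then show "(f u, f v) \<in> parcs (tree_closure ?T 0)"
      using path_ancestor[of "f u" "f v" m] path_ancestor[of "f v" "f u" m]
      by (cases "f u \<le> f v") (auto simp: tree_closure_def)
  qed
  then have "\<exists>h. ?P h" using T by blast
  then have "?P (connected_tree_depth C)"
    unfolding connected_tree_depth_def by (rule LeastI_ex)
  then obtain T :: "(nat, nat \<times> nat) pre_digraph" and r S where
    TS: "rooted_tree T r" "tree_height T r = connected_tree_depth C"
      "subgraph S (with_proj (tree_closure T r))" "digraph_iso C S" by blast
  from closure_pullback[OF TS(3,4)] show ?thesis using that[OF TS(1,2)] by metis
qed

lemma star_tree_depth:
  assumes C: "digraph C" and c: "c \<in> verts C" and arcs: "\<And>u v. u \<rightarrow>\<^bsub>C\<^esub> v \<Longrightarrow> u = c \<or> v = c"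
  shows "connected_tree_depth C \<le> 2"
proof -
  interpret digraph C by (rule C)
  define m where "m = Suc (card (verts C - {c}))"
  let ?T = "ptree (\<lambda>_. 0) m"
  have T: "rooted_tree ?T 0" by (rule rooted_tree_ptree) (auto simp: m_def)
  obtain g where g: "bij_betw g (verts C - {c}) {..<card (verts C - {c})}"
    using ex_bij_betw_finite_nat[of "verts C - {c}"] by (auto simp: atLeast0LessThan)
  define f where "f = (\<lambda>u. if u = c then 0 else Suc (g u))"
  have matching_size: "f u < m" if "u \<in> verts C" for u using g that by (auto simp: bij_betw_def f_def m_def)
  have "\<exists>S. subgraph S (with_proj (tree_closure ?T 0)) \<and> digraph_iso C S"
  proof (rule closure_embedding[OF T C])
    show "inj_on f (verts C)" using g by (auto simp: bij_betw_def inj_on_def f_def)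
    show "f ` verts C \<subseteq> verts ?T" using matching_size by auto
    fix u v assume uv: "u \<rightarrow>\<^bsub>C\<^esub> v"
    then have uv': "u \<in> verts C" "v \<in> verts C" "u \<noteq> v" "u = c \<or> v = c"
      using adj_not_same arcs by auto
    then have "f u \<noteq> f v" by (auto simp: f_def)
    moreover have "f u = 0 \<or> f v = 0" using uv' by (auto simp: f_def)
    ultimately show "(f u, f v) \<in> parcs (tree_closure ?T 0)"
      using star_ancestor[of m] matching_size uv'(1,2) by (auto simp: tree_closure_def)
  qed
  then have "connected_tree_depth C \<le> tree_height ?T 0"
    unfolding connected_tree_depth_def using T by (intro Least_le) blast
  also have "\<dots> \<le> 2" by (rule star_height) (simp add: m_def)
  finally show ?thesis .
qed

text \<open>A star forest, encoded by marking the centres and sending each leaf to its centre; such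
  data translate directly into the coordinates of the fan.\<close>

definition centre_leaf :: "('a \<Rightarrow> bool) \<Rightarrow> ('a \<Rightarrow> 'a) \<Rightarrow> 'a \<Rightarrow> 'a \<Rightarrow> bool" where
  "centre_leaf cen par u v \<longleftrightarrow> cen u \<and> \<not> cen v \<and> par v = u \<or> cen v \<and> \<not> cen u \<and> par u = v"

lemma tree_depth_2_star:
  assumes C: "digraph C" "verts C \<noteq> {}" "connected_tree_depth C \<le> 2"
  obtains cen par where "\<And>u v. u \<rightarrow>\<^bsub>C\<^esub> v \<Longrightarrow> centre_leaf cen par u v"
proof -
  interpret digraph C by (rule C)
  obtain T :: "(nat, nat \<times> nat) pre_digraph" and r f where T: "rooted_tree T r"
    "tree_height T r = connected_tree_depth C" "inj_on f (verts C)"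
    "\<And>u v. u \<rightarrow>\<^bsub>C\<^esub> v \<Longrightarrow> (f u, f v) \<in> parcs (tree_closure T r)"
    using connected_tree_depth_witness[OF C(1,2)] by metis
  \<comment> \<open>Every edge has an end that maps to the root, so one constant centre suffices; if
    no vertex maps to the root, there are no edges and the value is arbitrary.\<close>
  define par where "par = (\<lambda>_::'a. inv_into (verts C) f r)"
  show ?thesis
  proof (rule that[of "\<lambda>u. f u = r" par])
    fix u v assume uv: "u \<rightarrow>\<^bsub>C\<^esub> v"
    then have V: "u \<in> verts C" "v \<in> verts C" "u \<noteq> v" using adj_not_same by auto
    then have "f u \<noteq> f v" using T(3) by (auto simp: inj_on_def)
    moreover have "f u = r \<or> f v = r" by (rule closure_height_2[OF T(1) _ T(4)[OF uv]]) (use T C in simp)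
    ultimately show "centre_leaf (\<lambda>u. f u = r) par u v"
      using T(3) V by (auto simp: centre_leaf_def par_def)
  qed
qed

lemma tree_depth_3_fan:
  assumes C: "digraph C" "verts C \<noteq> {}" "connected_tree_depth C \<le> 3"
  obtains r cen par where "\<And>u v. u \<rightarrow>\<^bsub>C\<^esub> v \<Longrightarrow> u \<noteq> r \<Longrightarrow> v \<noteq> r \<Longrightarrow> centre_leaf cen par u v"
proof -
  interpret digraph C by (rule C)
  obtain T :: "(nat, nat \<times> nat) pre_digraph" and r f where T: "rooted_tree T r"
    "tree_height T r = connected_tree_depth C" "inj_on f (verts C)"
    "\<And>u v. u \<rightarrow>\<^bsub>C\<^esub> v \<Longrightarrow> (f u, f v) \<in> parcs (tree_closure T r)"
    using connected_tree_depth_witness[OF C(1,2)] by metis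
  obtain cen par where cp: "\<And>u v. (u, v) \<in> parcs (tree_closure T r) \<Longrightarrow> u \<noteq> r \<Longrightarrow> v \<noteq> r \<Longrightarrow>
     cen u \<and> \<not> cen v \<and> par v = u \<or> cen v \<and> \<not> cen u \<and> par u = v"
    using closure_height_3[OF T(1)] C(3) T(2) by metis
  define r' where "r' = inv_into (verts C) f r"
  define par' where "par' = (\<lambda>v. inv_into (verts C) f (par (f v)))"
  have r': "f u \<noteq> r" if "u \<in> verts C" "u \<noteq> r'" for u
    using that T(3) by (auto simp: r'_def)
  show ?thesis
  proof (rule that[of r' "cen \<circ> f" par'])
    fix u v assume uv: "u \<rightarrow>\<^bsub>C\<^esub> v" "u \<noteq> r'" "v \<noteq> r'"
    then have V: "u \<in> verts C" "v \<in> verts C" by auto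
    then show "centre_leaf (cen \<circ> f) par' u v"
      using cp[OF T(4)[OF uv(1)] r'[OF V(1) uv(2)] r'[OF V(2) uv(3)]] T(3)
      by (auto simp: centre_leaf_def par'_def)
  qed
qed

section \<open>Components and the shape of the excluded graph\<close>

context graph
begin

lemma finite_sccs: "finite sccs"
  using finite_sccs_verts inj_on_verts_sccs unfolding sccs_verts_conv by (rule finite_imageD)

lemma sccs_digraph: "C \<in> sccs \<Longrightarrow> digraph C"
  using digraphI_induced in_sccs_imp_induced by blast

lemma sccs_verts_nonempty: "C \<in> sccs \<Longrightarrow> verts C \<noteq> {}"
  by (auto simp: strongly_connected_def)

lemma sccs_tree_depth: "C \<in> sccs \<Longrightarrow> tree_depth C = connected_tree_depth C"
proof -
  assume C: "C \<in> sccs"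
  interpret C: digraph C by (rule sccs_digraph[OF C])
  have "C.sccs = {C}" using C C.strongly_connected_eq_iff by blast
  then show ?thesis by (simp add: tree_depth_def)
qed

lemma sccs_dominates:
  assumes "C \<in> sccs" "u \<rightarrow>\<^bsub>C\<^esub> v"
  shows "u \<rightarrow> v" "u \<in> verts C" "v \<in> verts C"
proof -
  show "u \<rightarrow> v" using adj_mono[OF assms(2)] assms(1) in_sccs_imp_induced induced_imp_subgraph by blast
  interpret C: digraph C by (rule sccs_digraph[OF assms(1)])
  show "u \<in> verts C" "v \<in> verts C" using assms(2) by auto
qed

lemma dominates_sccs:
  assumes "u \<rightarrow> v"
  obtains C where "C \<in> sccs" "u \<rightarrow>\<^bsub>C\<^esub> v"
proof -
  let ?C = "G \<restriction> {w. u \<rightarrow>\<^sup>* w}"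
  have u: "u \<in> verts G" "u \<rightarrow>\<^sup>* v" using assms by auto
  then have "?C \<in> sccs" by (intro induce_reachable_is_in_sccs)
  moreover have "u \<rightarrow>\<^bsub>?C\<^esub> v"
    using assms u by (auto simp: arcs_ends_conv)
  ultimately show ?thesis by (rule that)
qed

lemma connected_tree_depth_le:
  assumes "C \<in> sccs"
  shows "connected_tree_depth C \<le> tree_depth G"
  unfolding tree_depth_def using assms finite_sccs by (intro cSUP_upper) auto

text \<open>The centre and parent maps are glued along the components. A single vertex
  \<open>r\<close> is enough because at most one component has tree-depth above 2.\<close>

lemma star_forest_structure:
  assumes "tree_depth G = 3" "card {C \<in> sccs. tree_depth C = 3} \<le> 1"
  obtains r cen par where "\<And>u v. u \<rightarrow> v \<Longrightarrow> u \<noteq> r \<Longrightarrow> v \<noteq> r \<Longrightarrow> centre_leaf cen par u v"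
proof -
  have le3: "connected_tree_depth C \<le> 3" if "C \<in> sccs" for C
    using connected_tree_depth_le[OF that] assms(1) by simp
  have uniq: "C = C'" if "C \<in> sccs" "C' \<in> sccs" "\<not> connected_tree_depth C \<le> 2" "\<not> connected_tree_depth C' \<le> 2" for C C'
  proof -
    have "C \<in> {C \<in> sccs. tree_depth C = 3}" "C' \<in> {C \<in> sccs. tree_depth C = 3}"
      using that le3[OF that(1)] le3[OF that(2)] sccs_tree_depth by auto
    moreover have "finite {C \<in> sccs. tree_depth C = 3}" using finite_sccs by simp
    ultimately show ?thesis using assms(2) card_le_Suc0_iff_eq[of "{C \<in> sccs. tree_depth C = 3}"] by simp
  qed
  have "\<exists>r cen par. \<forall>u v. u \<rightarrow>\<^bsub>C\<^esub> v \<longrightarrow> connected_tree_depth C \<le> 2 \<or> u \<noteq> r \<and> v \<noteq> r \<longrightarrow> centre_leaf cen par u v"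
    if C: "C \<in> sccs" for C
  proof (cases "connected_tree_depth C \<le> 2")
    case True
    obtain cen par where "\<And>u v. u \<rightarrow>\<^bsub>C\<^esub> v \<Longrightarrow> centre_leaf cen par u v"
      using tree_depth_2_star[OF sccs_digraph[OF C] sccs_verts_nonempty[OF C] True] by blast
    then show ?thesis by blast
  next
    case False
    obtain r cen par where "\<And>u v. u \<rightarrow>\<^bsub>C\<^esub> v \<Longrightarrow> u \<noteq> r \<Longrightarrow> v \<noteq> r \<Longrightarrow> centre_leaf cen par u v"
      using tree_depth_3_fan[OF sccs_digraph[OF C] sccs_verts_nonempty[OF C] le3[OF C]] by blast
    then show ?thesis using False by blast
  qed
  then obtain r cen par where rcp: "\<And>C u v. C \<in> sccs \<Longrightarrow> u \<rightarrow>\<^bsub>C\<^esub> v \<Longrightarrow>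
      connected_tree_depth C \<le> 2 \<or> u \<noteq> r C \<and> v \<noteq> r C \<Longrightarrow> centre_leaf (cen C) (par C) u v"
    by metis
  define comp where "comp = (\<lambda>v. SOME C. C \<in> sccs \<and> v \<in> verts C)"
  have comp: "comp v = C" if "C \<in> sccs" "v \<in> verts C" for v C
  proof -
    have "comp v \<in> sccs \<and> v \<in> verts (comp v)" unfolding comp_def by (rule someI) (use that in blast)
    then show ?thesis using scc_disj[of "comp v" C] that by blast
  qed
  define C3 where "C3 = (SOME C. C \<in> sccs \<and> \<not> connected_tree_depth C \<le> 2)"
  have C3: "C = C3" if "C \<in> sccs" "\<not> connected_tree_depth C \<le> 2" for C
  proof -
    have "C3 \<in> sccs \<and> \<not> connected_tree_depth C3 \<le> 2" unfolding C3_def by (rule someI) (use that in blast)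
    then show ?thesis using uniq that by blast
  qed
  show ?thesis
  proof (rule that[of "r C3" "\<lambda>v. cen (comp v) v" "\<lambda>v. par (comp v) v"])
    fix u v assume uv: "u \<rightarrow> v" "u \<noteq> r C3" "v \<noteq> r C3"
    obtain C where C: "C \<in> sccs" "u \<rightarrow>\<^bsub>C\<^esub> v" using dominates_sccs[OF uv(1)] .
    have "centre_leaf (cen C) (par C) u v"
      by (rule rcp[OF C]) (use C3[OF C(1)] uv in blast)
    moreover have "comp u = C" "comp v = C" using comp sccs_dominates[OF C] C(1) by auto
    ultimately show "centre_leaf (\<lambda>v. cen (comp v) v) (\<lambda>v. par (comp v) v) u v"
      by (simp add: centre_leaf_def)
  qed
qed

lemma connected_induce:
  assumes "B \<subseteq> verts G" "conn (\<lambda>u v. u \<rightarrow> v) B"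
  shows "connected (G \<restriction> B)"
proof -
  interpret B: wf_digraph "G \<restriction> B" by (rule wellformed_induce_subgraph)
  have "u \<rightarrow>\<^sup>*\<^bsub>G \<restriction> B\<^esub> v" if uv: "u \<in> B" "v \<in> B" for u v
  proof -
    have "(restr (\<lambda>u v. u \<rightarrow> v) B)\<^sup>*\<^sup>* u v" using assms(2) uv by (simp add: conn_def)
    then show ?thesis
    proof (induction rule: rtranclp_induct)
      case base
      then show ?case using uv by simp
    next
      case (step y z)
      then have "y \<rightarrow>\<^bsub>G \<restriction> B\<^esub> z" by (auto simp: arcs_ends_conv)
      then show ?case using step.IH B.reachable_adj_trans by blast
    qed
  qed
  then show ?thesis
    unfolding connected_def using assms(2) B.reachable_mk_symmetricI
    by (intro strongly_connectedI) (auto simp: conn_def)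
qed

end

lemma fan_imp_minor:
  assumes "graph H" "graph G"
    and H: "\<And>u v. u \<rightarrow>\<^bsub>H\<^esub> v \<Longrightarrow> u \<noteq> r \<Longrightarrow> v \<noteq> r \<Longrightarrow> centre_leaf cen par u v"
    and fan: "has_fan (card (verts H) + 1) (verts G) (\<lambda>u v. u \<rightarrow>\<^bsub>G\<^esub> v)"
  shows "is_minor H G"
proof -
  interpret H: graph H by fact
  interpret G: graph G by fact
  let ?E = "\<lambda>u v. u \<rightarrow>\<^bsub>G\<^esub> v"
  define n where "n = card (verts H)"
  have "has_fan (n + 1) (verts G) ?E" using fan by (simp add: n_def)
  then obtain B where B: "\<And>p. p \<in> fan_verts (n + 1) \<Longrightarrow> B p \<subseteq> verts G \<and> conn ?E (B p)"
    and dB: "disjoint_family_on B (fan_verts (n + 1))"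
    and t0: "\<forall>i<n + 1. touch ?E (B (0, 0)) (B (Suc i, 0)) \<and> (\<forall>l<n + 1.
      touch ?E (B (0, 0)) (B (Suc i, Suc l)) \<and> touch ?E (B (Suc i, 0)) (B (Suc i, Suc l)))"
    unfolding has_fan_def by blast
  have t: "touch ?E (B (0, 0)) (B (Suc i, 0))" if "i \<le> n" for i
    using t0 that by (simp add: less_Suc_eq_le)
  have t2: "touch ?E (B (0, 0)) (B (Suc i, Suc l))"
    "touch ?E (B (Suc i, 0)) (B (Suc i, Suc l))" if "i \<le> n" "l \<le> n" for i l
    using t0 that by (simp_all add: less_Suc_eq_le)
  obtain g where g: "bij_betw g (verts H) {..<n}"
    using ex_bij_betw_finite_nat[OF H.finite_verts] by (auto simp: n_def atLeast0LessThan)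
  \<comment> \<open>\<open>par\<close> may lead outside \<open>verts H\<close>, for instance at an
    isolated vertex; such values get the spare index \<open>n\<close>, which is why the fan has one
    star more than \<open>H\<close> has vertices.\<close>
  define ix where "ix = (\<lambda>v. if v \<in> verts H then g v else n)"
  have ix: "ix v \<le> n" for v using g by (force simp: ix_def bij_betw_def intro: less_imp_le)
  \<comment> \<open>Except at \<open>r\<close>, the last nonzero coordinate encodes the vertex
    itself, whence injectivity on \<open>verts H\<close>.\<close>
  define \<phi> where "\<phi> = (\<lambda>v. if v = r then (0, 0) else if cen v then (Suc (ix v), 0)
     else (Suc (ix (par v)), Suc (ix v)))"
  have \<phi>V: "\<phi> v \<in> fan_verts (n + 1)" for v
    using ix[of v] ix[of "par v"] by (auto simp: \<phi>_def intro!: fan_vertsI simp: less_Suc_eq_le)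
  have \<phi>inj: "u = v" if "u \<in> verts H" "v \<in> verts H" "\<phi> u = \<phi> v" for u v
  proof -
    have "ix u = ix v \<longrightarrow> u = v" using that(1,2) g by (auto simp: ix_def bij_betw_def inj_on_def)
    then show ?thesis using that(3) by (auto simp: \<phi>_def split: if_splits)
  qed
  have t': "touch ?E (B p) (B q)" if "touch ?E (B q) (B p)" for p q
    by (rule touch_sym[OF _ that]) (auto intro!: sympI G.graph_symmetric)
  have \<phi>t: "touch ?E (B (\<phi> u)) (B (\<phi> v))" if uv: "u \<rightarrow>\<^bsub>H\<^esub> v" for u v
  proof -
    have root: "touch ?E (B (0, 0)) (B (\<phi> w))" if "w \<noteq> r" for w
      using that t t2 ix by (auto simp: \<phi>_def)
    have leaf: "touch ?E (B (\<phi> w)) (B (\<phi> x))" if "cen w" "\<not> cen x" "par x = w" "w \<noteq> r" "x \<noteq> r" for w x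
      using that t t2 ix by (auto simp: \<phi>_def)
    have "u \<noteq> v" using uv H.adj_not_same by auto
    consider "u = r" | "v = r" | "u \<noteq> r" "v \<noteq> r" by blast
    then show ?thesis
    proof cases
      case 1
      then show ?thesis using root[of v] \<open>u \<noteq> v\<close> by (simp add: \<phi>_def)
    next
      case 2
      then show ?thesis using t'[OF root[of u]] \<open>u \<noteq> v\<close> by (simp add: \<phi>_def)
    next
      case 3
      then show ?thesis using H[OF uv 3] leaf t' unfolding centre_leaf_def by blast
    qed
  qed
  show ?thesis
    unfolding is_minor_def
  proof (intro exI[of _ "\<lambda>u. B (\<phi> u)"] conjI ballI allI impI)
    fix u assume "u \<in> verts H"
    show "B (\<phi> u) \<subseteq> verts G" "connected (G \<restriction> B (\<phi> u))"
      using B[OF \<phi>V] G.connected_induce by auto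
  next
    show "disjoint_family_on (\<lambda>u. B (\<phi> u)) (verts H)"
      using dB \<phi>V \<phi>inj unfolding disjoint_family_on_def by metis
  next
    fix u v assume "u \<rightarrow>\<^bsub>H\<^esub> v"
    then show "\<exists>x\<in>B (\<phi> u). \<exists>y\<in>B (\<phi> v). x \<rightarrow>\<^bsub>G\<^esub> y" using \<phi>t unfolding touch_def by blast
  qed
qed

section \<open>The lower bound by stars\<close>

lemma star_dominates: "x \<rightarrow>\<^bsub>ptree (\<lambda>_. 0) m\<^esub> y \<longleftrightarrow> x < m \<and> y < m \<and> x \<noteq> y \<and> (x = 0 \<or> y = 0)"
  by (auto simp: arcs_ends_conv image_iff)

text \<open>Every edge of the star contains \<open>0\<close>, so every edge of \<open>H\<close> has
  an end whose branch set contains \<open>0\<close>. By disjointness this is always the same vertex,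
  and each component is a star.\<close>

lemma minor_of_star:
  assumes "graph H" "is_minor H (ptree (\<lambda>_. 0) m)"
  shows "tree_depth H \<le> 2"
proof -
  interpret H: graph H by fact
  obtain B where dB: "disjoint_family_on B (verts H)"
    and B: "\<And>u v. u \<rightarrow>\<^bsub>H\<^esub> v \<Longrightarrow> \<exists>x\<in>B u. \<exists>y\<in>B v. x \<rightarrow>\<^bsub>ptree (\<lambda>_. 0) m\<^esub> y"
    using assms(2) unfolding is_minor_def by blast
  have zero: "0 \<in> B u \<or> 0 \<in> B v" if "u \<rightarrow>\<^bsub>H\<^esub> v" for u v
    using B[OF that] unfolding star_dominates by auto
  have "connected_tree_depth C \<le> 2" if C: "C \<in> H.sccs" for C
  proof -
    obtain c0 where c0: "c0 \<in> verts C" using H.sccs_verts_nonempty[OF C] by blast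
    \<comment> \<open>A component whose branch sets all miss \<open>0\<close> has no edges, and any
      of its vertices may serve as centre.\<close>
    define c where "c = (if \<exists>c\<in>verts C. 0 \<in> B c then SOME c. c \<in> verts C \<and> 0 \<in> B c else c0)"
    have c: "c \<in> verts C" "0 \<in> B c \<or> (\<forall>u\<in>verts C. 0 \<notin> B u)"
      using c0 someI_ex[of "\<lambda>c. c \<in> verts C \<and> 0 \<in> B c"] by (auto simp: c_def)
    have CV: "verts C \<subseteq> verts H" using H.in_sccs_imp_induced[OF C] by auto
    show ?thesis
    proof (rule star_tree_depth[OF H.sccs_digraph[OF C] c(1)])
      fix u v assume "u \<rightarrow>\<^bsub>C\<^esub> v"
      then have uv: "u \<rightarrow>\<^bsub>H\<^esub> v" "u \<in> verts C" "v \<in> verts C" using H.sccs_dominates[OF C] by auto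
      have "w = c" if w: "w \<in> verts C" "0 \<in> B w" for w
      proof (rule ccontr)
        assume "w \<noteq> c"
        then have "B w \<inter> B c = {}" using disjoint_family_onD[OF dB] w(1) c(1) CV by blast
        then show False using w c(2) by blast
      qed
      then show "u = c \<or> v = c" using zero[OF uv(1)] uv(2,3) by blast
    qed
  qed
  then show ?thesis
    unfolding tree_depth_def by (cases "H.sccs = {}") (auto intro: cSUP_least)
qed

text \<open>With \<open>d + 2\<close> vertices the centre has \<open>d + 1\<close> neighbours, one
  more than the defect allows when all colours agree.\<close>

lemma star_not_colourable:
  assumes "k < 2"
  shows "\<not> defective_colourable k d (ptree (\<lambda>_. 0) (d + 2))"
proof
  let ?G = "ptree (\<lambda>_. 0) (d + 2)"
  assume "defective_colourable k d ?G"
  then obtain c :: "nat \<Rightarrow> nat" where c: "\<And>v. v < d + 2 \<Longrightarrow> c v < k"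
    "card {w \<in> verts ?G. 0 \<rightarrow>\<^bsub>?G\<^esub> w \<and> c w = c 0} \<le> d"
    unfolding defective_colourable_def by force
  have "c v = 0" if "v < d + 2" for v using c(1)[OF that] assms by simp
  then have "{w \<in> verts ?G. 0 \<rightarrow>\<^bsub>?G\<^esub> w \<and> c w = c 0} = {1..<d + 2}"
    unfolding star_dominates by auto
  then show False using c(2) by simp
qed

lemma fan_free_colourable:
  assumes "graph G" "0 < k" "\<not> has_fan k (verts G) (\<lambda>u v. u \<rightarrow>\<^bsub>G\<^esub> v)"
  shows "defective_colourable 2 (hub_degree k + light_bound k) G"
proof -
  interpret G: graph G by fact
  interpret fan_free "verts G" "\<lambda>u v. u \<rightarrow>\<^bsub>G\<^esub> v" k
  proof
    show "symp (\<lambda>u v. u \<rightarrow>\<^bsub>G\<^esub> v)" by (rule sympI) (rule G.graph_symmetric)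
    show "\<not> x \<rightarrow>\<^bsub>G\<^esub> x" for x using G.adj_not_same by blast
    show "x \<in> verts G \<and> y \<in> verts G" if "x \<rightarrow>\<^bsub>G\<^esub> y" for x y using that by auto
  qed (use assms in simp_all)
  obtain f :: "'a \<Rightarrow> bool" where
    f: "\<forall>v\<in>verts G. card {w \<in> verts G. v \<rightarrow>\<^bsub>G\<^esub> w \<and> f w = f v} \<le> hub_degree k + light_bound k"
    using two_colouring by blast
  have "(of_bool (f w) :: nat) = of_bool (f v) \<longleftrightarrow> f w = f v" for v w by simp
  then show ?thesis
    unfolding defective_colourable_def using f by (intro exI[of _ "\<lambda>v. of_bool (f v)"]) auto
qed

theorem theorem35:
  fixes H :: "('a, 'b) pre_digraph"
  assumes "graph H"
    and "tree_depth H = 3"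
    and "card {C \<in> pre_digraph.sccs H. tree_depth C = 3} \<le> 1"
  shows "defective_chromatic_number (minor_free_graphs H) = 2"
proof -
  interpret H: graph H by fact
  obtain r cen par where struct: "\<And>u v. u \<rightarrow>\<^bsub>H\<^esub> v \<Longrightarrow> u \<noteq> r \<Longrightarrow> v \<noteq> r \<Longrightarrow> centre_leaf cen par u v"
    using H.star_forest_structure[OF assms(2,3)] by blast
  let ?k = "card (verts H) + 1"
  have "defective_colourable 2 (hub_degree ?k + light_bound ?k) G" if "G \<in> minor_free_graphs H" for G
  proof (rule fan_free_colourable)
    show "graph G" using that by (simp add: minor_free_graphs_def)
    then show "\<not> has_fan ?k (verts G) (\<lambda>u v. u \<rightarrow>\<^bsub>G\<^esub> v)"
      using fan_imp_minor[OF assms(1) _ struct] that by (auto simp: minor_free_graphs_def)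
  qed simp
  then have upper: "defective_chromatic_number (minor_free_graphs H) \<le> enat 2"
    unfolding defective_chromatic_number_def by (intro Inf_lower) blast
  have "2 \<le> k" if "\<forall>G\<in>minor_free_graphs H. defective_colourable k d G" for k d
  proof (rule ccontr)
    assume "\<not> 2 \<le> k"
    then have "\<not> defective_colourable k d (ptree (\<lambda>_. 0) (d + 2))"
      by (intro star_not_colourable) simp
    then have "ptree (\<lambda>_. 0) (d + 2) \<notin> minor_free_graphs H" using that by blast
    then have "is_minor H (ptree (\<lambda>_. 0) (d + 2))"
      using graph_ptree[of "\<lambda>_. 0"] by (auto simp: minor_free_graphs_def)
    then show False using minor_of_star[OF assms(1)] assms(2) by fastforce
  qed
  then have "enat 2 \<le> defective_chromatic_number (minor_free_graphs H)"
    unfolding defective_chromatic_number_def by (intro Inf_greatest) auto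
  then show ?thesis using upper by (simp add: numeral_eq_enat)
qed

end
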